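(* There is an absolute constant $C>0$ and, for every $n\ge 2$ and $\delta\in(0,1/2]$, an algorithm $\mathcal{A}_{n,\delta}$ for the $n$-armed bandit model such that the following holds. For every instance whose arms, after relabeling, satisfy $\theta_1>\theta_2\ge\cdots\ge\theta_n$ (the labeling/ordering being unknown to the algorithm), with probability at least $1-\delta$ the algorithm $\mathcal{A}_{n,\delta}$ outputs the best arm (the arm with mean $\theta_1$) and uses at most $$C\sum_{i=1}^n\Big(\frac{\sigma_i^2}{\Delta_i^2}+\frac{1}{\Delta_i}\Big)\big(\ln\delta^{-1}+\mathrm{LL}(\Delta_i^{-1})\big)$$ samples.
   Context: Bandit model: there are $n\ge2$ arms; each time arm $i$ is sampled (pulled), one observes an independent draw from an unknown distribution $\mathcal{D}_i$ supported on $[0,1]$ with mean $\theta_i$ and variance $\sigma_i^2$. An algorithm adaptively chooses (possibly using internal randomness) which arm to sample next based on all past observations, and eventually stops and outputs an arm; its sample complexity is the total number of samples taken. For an instance with $\theta_1>\theta_2\ge\cdots\ge\theta_n$ we write $\Delta_i=\theta_1-\theta_i$ for $i\ge2$ and $\Delta_1=\Delta_2$. For $x\ge1$, $\mathrm{LL}(x):=\ln(e+\ln x)$. *)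

theory Defs
  imports "HOL-Probability.Probability"
begin

datatype action = Pull nat | Stop nat

text \<open>A (randomized) bandit algorithm: given its internal random seed (a real drawn uniformly
  from [0,1]) and the history of past (arm, observation) pairs, it decides the next action.\<close>
type_synonym policy = "real \<Rightarrow> (nat \<times> real) list \<Rightarrow> action"

definition valid_policy :: "nat \<Rightarrow> policy \<Rightarrow> bool" where
  "valid_policy n A \<longleftrightarrow> (\<forall>u h i. (A u h = Pull i \<longrightarrow> i < n) \<and> (A u h = Stop i \<longrightarrow> i < n))"

definition pulls :: "(nat \<times> real) list \<Rightarrow> nat \<Rightarrow> nat" where
  "pulls h i = length (filter (\<lambda>p. fst p = i) h)"

text \<open>Reward tape model: x (i,k) is the (k+1)-st observation of arm i.\<close>
definition step :: "policy \<Rightarrow> real \<Rightarrow> (nat \<times> nat \<Rightarrow> real) \<Rightarrow> (nat \<times> real) list \<Rightarrow> (nat \<times> real) list" where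
  "step A u x h = (case A u h of Pull i \<Rightarrow> h @ [(i, x (i, pulls h i))] | Stop j \<Rightarrow> h)"

definition history :: "policy \<Rightarrow> real \<Rightarrow> (nat \<times> nat \<Rightarrow> real) \<Rightarrow> nat \<Rightarrow> (nat \<times> real) list" where
  "history A u x t = (step A u x ^^ t) []"

definition outcome_space :: "nat \<Rightarrow> (nat \<Rightarrow> real measure) \<Rightarrow> (real \<times> (nat \<times> nat \<Rightarrow> real)) measure" where
  "outcome_space n D = uniform_measure lborel {0..1::real} \<Otimes>\<^sub>M PiM ({..<n} \<times> UNIV) (\<lambda>p. D (fst p))"

definition success_event :: "nat \<Rightarrow> (nat \<Rightarrow> real measure) \<Rightarrow> policy \<Rightarrow> nat \<Rightarrow> real \<Rightarrow> (real \<times> (nat \<times> nat \<Rightarrow> real)) set" where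
  "success_event n D A b B = {\<omega> \<in> space (outcome_space n D).
      \<exists>t. A (fst \<omega>) (history A (fst \<omega>) (snd \<omega>) t) = Stop b
          \<and> real (length (history A (fst \<omega>) (snd \<omega>) t)) \<le> B}"

definition bandit_instance :: "nat \<Rightarrow> (nat \<Rightarrow> real measure) \<Rightarrow> bool" where
  "bandit_instance n D \<longleftrightarrow> (\<forall>i<n. prob_space (D i) \<and> sets (D i) = sets borel \<and> measure (D i) {0..1} = 1)"

definition mean :: "real measure \<Rightarrow> real" where
  "mean M = (\<integral>x. x \<partial>M)"

definition var :: "real measure \<Rightarrow> real" where
  "var M = (\<integral>x. (x - mean M)^2 \<partial>M)"

definition gap :: "nat \<Rightarrow> (nat \<Rightarrow> real) \<Rightarrow> nat \<Rightarrow> nat \<Rightarrow> real" where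
  "gap n \<theta> b i = (if i = b then Min {\<theta> b - \<theta> j | j. j < n \<and> j \<noteq> b} else \<theta> b - \<theta> i)"

definition LL :: "real \<Rightarrow> real" where
  "LL x = ln (exp 1 + ln x)"

end

theory Submission
  imports Defs "HOL-Library.Discrete_Functions"
begin

text \<open>The policy keeps, for every arm, the empirical mean and variance of its last completed dyadic
  block of samples. It takes the arm \<open>h\<close> with the largest upper confidence bound (at a base level
  \<open>q\<close> of order \<open>ln (1/\<delta>)\<close>, without a union bound over the arms) and the runner-up \<open>l\<close>, stops when a
  stricter lower bound of \<open>h\<close> exceeds the upper bound of \<open>l\<close>, and otherwise pulls the one of the two
  with the larger radius, unless that arm already received more than half of all samples.

  Three events are excluded. First, the upper bounds of the best arm fail. Second, the
  total cost of arms whose bounds fail at level \<open>q + m\<close>, \<open>m = 0, 1, \<dots>\<close>, exceeds its order of magnitude: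
  Markov's inequality for the weighted sum over the arms avoids the factor \<open>ln n\<close>. Third,
  some strict lower bound fails: the level of the block that an arm enters with its \<open>N\<close>-th sample, when
  \<open>t\<close> samples have been taken in total, gives failure probability of order \<open>(N/t)\<^sup>2\<close>; it is fixed before the
  block is observed, and since the \<open>m\<close>-th arm to reach \<open>N\<close> samples does so at a time \<open>t \<ge> m N\<close>, these
  probabilities are summable. Outside these events, a suboptimal arm
  is pulled only while its count is below its budget or while the best arm holds
  most of the samples and has itself not exhausted its budget; and the best arm never gets much more
  than half of the samples.\<close>

section \<open>Concentration on a block of samples\<close>

lemma exp_le_one_plus_square:
  fixes z :: real
  assumes "\<bar>z\<bar> \<le> 1"
  shows "exp z \<le> 1 + z + z\<^sup>2"
proof (cases "z \<ge> 0")
  case True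
  then show ?thesis using exp_bound[of z] assms by auto
next
  case False
  define y where "y = - z"
  have y: "0 < y" "y \<le> 1" using False assms by (auto simp: y_def)
  have "1 \<le> 1 + y ^ 3"
    using y by simp
  also have "1 + y ^ 3 = (1 - y + y\<^sup>2) * (1 + y)"
    by (simp add: algebra_simps power2_eq_square power3_eq_cube)
  also have "(1 - y + y\<^sup>2) * (1 + y) \<le> (1 - y + y\<^sup>2) * exp y"
    using exp_ge_add_one_self[of y] y by (intro mult_left_mono) (auto intro: add_nonneg_nonneg)
  finally have "exp (- y) \<le> 1 - y + y\<^sup>2"
    by (simp add: exp_minus inverse_eq_divide pos_divide_le_eq)
  then show ?thesis by (simp add: y_def)
qed

lemma exp_le_one_plus_double:
  fixes z :: real
  assumes "0 \<le> z" "z \<le> 1"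
  shows "exp z \<le> 1 + 2 * z"
proof -
  have "z * z \<le> z * 1" by (intro mult_left_mono) (use assms in auto)
  then show ?thesis using exp_bound[of z] assms by (auto simp: power2_eq_square)
qed

lemma exp_minus_le_half:
  fixes z :: real
  assumes "0 \<le> z" "z \<le> 1"
  shows "exp (- z) \<le> 1 - z / 2"
proof -
  have "z * z \<le> z * 1" by (intro mult_left_mono) (use assms in auto)
  then have "1 \<le> (1 - z / 2) * (1 + z)"
    by (simp add: algebra_simps)
  also have "\<dots> \<le> (1 - z / 2) * exp z"
    using exp_ge_add_one_self[of z] assms by (intro mult_left_mono) auto
  finally show ?thesis by (simp add: exp_minus inverse_eq_divide pos_divide_le_eq)
qed

text \<open>Markov's inequality for the exponential of the sum, whose expectation factorises by
  independence. Integrals in \<open>ennreal\<close> avoid integrability conditions.\<close>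

lemma (in prob_space) chernoff_indep_sum:
  fixes f :: "'b \<Rightarrow> 'a \<Rightarrow> real"
  assumes "finite I" "indep_vars (\<lambda>_. borel) f I"
    and mgf: "\<And>i. i \<in> I \<Longrightarrow> (\<integral>\<^sup>+\<omega>. ennreal (exp (f i \<omega>)) \<partial>M) \<le> ennreal (exp c)"
  shows "emeasure M {\<omega>\<in>space M. (\<Sum>i\<in>I. f i \<omega>) \<ge> real (card I) * c + x} \<le> ennreal (exp (- x))"
proof -
  let ?a = "real (card I) * c + x"
  have [measurable]: "f i \<in> borel_measurable M" if "i \<in> I" for i
    using assms(2) that by (auto simp: indep_vars_def)
  have indep: "indep_vars (\<lambda>_. borel) (\<lambda>i \<omega>. ennreal (exp (f i \<omega>))) I"
    using indep_vars_compose[OF assms(2), of "\<lambda>_ z. ennreal (exp z)" "\<lambda>_. borel"]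
    by (simp add: comp_def)
  have "{\<omega>\<in>space M. (\<Sum>i\<in>I. f i \<omega>) \<ge> ?a}
      = {\<omega>\<in>space M. 1 \<le> ennreal (exp (- ?a)) * (\<Prod>i\<in>I. ennreal (exp (f i \<omega>)))}"
    using assms(1)
    by (auto simp: prod_ennreal exp_sum[symmetric] ennreal_mult[symmetric] exp_add[symmetric]
        ennreal_1[symmetric] simp del: ennreal_1)
  also have "emeasure M \<dots> \<le> ennreal (exp (- ?a)) * (\<integral>\<^sup>+\<omega>. (\<Prod>i\<in>I. ennreal (exp (f i \<omega>))) * indicator (space M) \<omega> \<partial>M)"
    by (rule nn_integral_Markov_inequality) auto
  also have "(\<integral>\<^sup>+\<omega>. (\<Prod>i\<in>I. ennreal (exp (f i \<omega>))) * indicator (space M) \<omega> \<partial>M)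
      = (\<integral>\<^sup>+\<omega>. (\<Prod>i\<in>I. ennreal (exp (f i \<omega>))) \<partial>M)"
    by (intro nn_integral_cong) auto
  also have "\<dots> = (\<Prod>i\<in>I. \<integral>\<^sup>+\<omega>. ennreal (exp (f i \<omega>)) \<partial>M)"
    by (rule indep_vars_nn_integral[OF assms(1) indep]) auto
  also have "\<dots> \<le> (\<Prod>i\<in>I. ennreal (exp c))"
    by (intro prod_mono_ennreal) (use mgf in auto)
  also have "\<dots> = ennreal (exp (real (card I) * c))"
    by (simp add: ennreal_power exp_of_nat_mult)
  finally show ?thesis
    by (simp add: mult_left_mono ennreal_mult[symmetric] exp_add[symmetric])
qed

section \<open>Moment generating functions of distributions on the unit interval\<close>

locale unit_distribution = prob_space M for M :: "real measure" +
  assumes sets_eq_borel [measurable_cong]: "sets M = sets borel"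
    and AE_unit: "AE x in M. 0 \<le> x \<and> x \<le> 1"
begin

lemma integrable_unit:
  fixes f :: "real \<Rightarrow> real"
  assumes [measurable]: "f \<in> borel_measurable borel"
    and "\<And>x. 0 \<le> x \<Longrightarrow> x \<le> 1 \<Longrightarrow> \<bar>f x\<bar> \<le> B"
  shows "integrable M f"
  by (rule integrable_const_bound[where B = B]) (use AE_unit assms(2) in auto)

lemma integral_le_unit:
  fixes f g :: "real \<Rightarrow> real"
  assumes [measurable]: "f \<in> borel_measurable borel" "g \<in> borel_measurable borel"
    and "\<And>x. 0 \<le> x \<Longrightarrow> x \<le> 1 \<Longrightarrow> \<bar>f x\<bar> \<le> B" "\<And>x. 0 \<le> x \<Longrightarrow> x \<le> 1 \<Longrightarrow> \<bar>g x\<bar> \<le> B'"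
    and "\<And>x. 0 \<le> x \<Longrightarrow> x \<le> 1 \<Longrightarrow> f x \<le> g x"
  shows "(\<integral>x. f x \<partial>M) \<le> (\<integral>x. g x \<partial>M)"
  by (rule integral_mono_AE) (use AE_unit assms in \<open>auto intro!: integrable_unit\<close>)

lemma mean_bounds: "0 \<le> mean M" "mean M \<le> 1"
proof -
  have "(\<integral>x. 0 \<partial>M) \<le> (\<integral>x. x \<partial>M)" "(\<integral>x. x \<partial>M) \<le> (\<integral>x. 1 \<partial>M)"
    by (rule integral_le_unit[where B = 1 and B' = 1]; simp)+
  then show "0 \<le> mean M" "mean M \<le> 1" by (simp_all add: mean_def prob_space)
qed

lemma dev_bounds: "0 \<le> x \<Longrightarrow> x \<le> 1 \<Longrightarrow> \<bar>x - mean M\<bar> \<le> 1"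
  using mean_bounds by (auto simp: abs_le_iff)

lemma sq_dev_bounds: "0 \<le> x \<Longrightarrow> x \<le> 1 \<Longrightarrow> (x - mean M)\<^sup>2 \<le> 1"
  using dev_bounds[of x] by (simp add: abs_square_le_1)

lemma var_bounds: "0 \<le> var M" "var M \<le> 1"
proof -
  have "(\<integral>x. (x - mean M)\<^sup>2 \<partial>M) \<le> (\<integral>x. 1 \<partial>M)"
    by (rule integral_le_unit[where B = 1 and B' = 1]) (auto simp: sq_dev_bounds)
  then show "0 \<le> var M" "var M \<le> 1" by (simp_all add: var_def prob_space)
qed

text \<open>A quadratic majorant of the exponential suffices: its linear term integrates to zero,
  its quadratic term to \<open>c * var M\<close>, and \<open>1 + z \<le> exp z\<close> restores the
  exponential form.\<close>

lemma mgf_le: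
  fixes f :: "real \<Rightarrow> real"
  assumes [measurable]: "f \<in> borel_measurable borel"
    and bound: "\<And>x. 0 \<le> x \<Longrightarrow> x \<le> 1 \<Longrightarrow> exp (f x) \<le> 1 + a * (x - mean M) + c * (x - mean M)\<^sup>2"
  shows "(\<integral>\<^sup>+x. ennreal (exp (f x)) \<partial>M) \<le> ennreal (exp (c * var M))"
proof -
  have int1: "integrable M (\<lambda>x. x - mean M)"
    by (rule integrable_unit[where B = 1]) (auto simp: dev_bounds)
  have int2: "integrable M (\<lambda>x. (x - mean M)\<^sup>2)"
    by (rule integrable_unit[where B = 1]) (auto simp: sq_dev_bounds)
  have intx: "integrable M (\<lambda>x. x)"
    by (rule integrable_unit[where B = 1]) auto
  let ?g = "\<lambda>x. 1 + a * (x - mean M) + c * (x - mean M)\<^sup>2"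
  have intg: "integrable M ?g" using int1 int2 by auto
  have "(\<integral>\<^sup>+x. ennreal (exp (f x)) \<partial>M) \<le> (\<integral>\<^sup>+x. ennreal (?g x) \<partial>M)"
    by (rule nn_integral_mono_AE) (use AE_unit bound in \<open>auto intro!: ennreal_leI\<close>)
  also have "\<dots> = ennreal (\<integral>x. ?g x \<partial>M)"
  proof (rule nn_integral_eq_integral[OF intg])
    have "0 \<le> ?g x" if "0 \<le> x" "x \<le> 1" for x
      using bound[OF that] exp_ge_zero[of "f x"] by linarith
    then show "AE x in M. 0 \<le> ?g x" using AE_unit by auto
  qed
  also have "(\<integral>x. ?g x \<partial>M) = 1 + a * (\<integral>x. x - mean M \<partial>M) + c * var M"
    using int1 int2 by (simp add: var_def prob_space)
  also have "(\<integral>x. x - mean M \<partial>M) = 0"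
    using intx by (simp add: mean_def prob_space)
  also have "ennreal (1 + a * 0 + c * var M) \<le> ennreal (exp (c * var M))"
    using exp_ge_add_one_self[of "c * var M"] by (intro ennreal_leI) auto
  finally show ?thesis .
qed

lemma mgf_dev:
  assumes "\<bar>l\<bar> \<le> 1"
  shows "(\<integral>\<^sup>+x. ennreal (exp (l * (x - mean M))) \<partial>M) \<le> ennreal (exp (l\<^sup>2 * var M))"
proof (rule mgf_le)
  fix x :: real assume "0 \<le> x" "x \<le> 1"
  then have "\<bar>l * (x - mean M)\<bar> \<le> 1 * 1"
    unfolding abs_mult using assms dev_bounds by (intro mult_mono) auto
  then show "exp (l * (x - mean M)) \<le> 1 + l * (x - mean M) + l\<^sup>2 * (x - mean M)\<^sup>2"
    using exp_le_one_plus_square[of "l * (x - mean M)"] by (simp add: power_mult_distrib)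
qed simp

lemma mgf_sq_dev: "(\<integral>\<^sup>+x. ennreal (exp ((x - mean M)\<^sup>2)) \<partial>M) \<le> ennreal (exp (2 * var M))"
  by (rule mgf_le[where a = 0]) (use exp_le_one_plus_double sq_dev_bounds in auto)

lemma mgf_minus_sq_dev: "(\<integral>\<^sup>+x. ennreal (exp (- (x - mean M)\<^sup>2)) \<partial>M) \<le> ennreal (exp (- (1/2) * var M))"
proof (rule mgf_le[where a = 0])
  fix x :: real assume "0 \<le> x" "x \<le> 1"
  then show "exp (- (x - mean M)\<^sup>2) \<le> 1 + 0 * (x - mean M) + - (1/2) * (x - mean M)\<^sup>2"
    using exp_minus_le_half[of "(x - mean M)\<^sup>2"] sq_dev_bounds[of x] by simp
qed simp

end

text \<open>Indices start at 0, so \<open>block k\<close> comes right after the first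
  \<open>2 ^ k\<close> observations of an arm. The time at which an arm has \<open>2 ^ k\<close>
  samples is thus determined without looking at the block, and a confidence level may depend on
  it.\<close>

definition block :: "nat \<Rightarrow> nat set" where
  "block k = {2 ^ k..<2 ^ Suc k}"

definition block_mean :: "nat \<Rightarrow> (nat \<Rightarrow> real) \<Rightarrow> real" where
  "block_mean k y = (\<Sum>s\<in>block k. y s) / 2 ^ k"

definition block_dev :: "nat \<Rightarrow> (nat \<Rightarrow> real) \<Rightarrow> real" where
  "block_dev k y = (\<Sum>s\<in>block k. (y s - block_mean k y)\<^sup>2)"

text \<open>An empirical Bernstein radius: \<open>block_dev\<close> is \<open>2 ^ k\<close> times
  the empirical variance of the block.\<close>

definition radius :: "nat \<Rightarrow> (nat \<Rightarrow> real) \<Rightarrow> real \<Rightarrow> real" where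
  "radius k y x = (4 * sqrt (block_dev k y * x) + 16 * x) / 2 ^ k"

text \<open>Bernstein's bound for the sum, with two-sided control of the sum of squares so that
  empirical and true variance are comparable. The bound by \<open>2 ^ k\<close> holds almost surely
  for samples in the unit interval; it makes the quadratic correction of the empirical variance
  linear in the deviation.\<close>

definition concentrated :: "nat \<Rightarrow> (nat \<Rightarrow> real) \<Rightarrow> real \<Rightarrow> real \<Rightarrow> real \<Rightarrow> bool" where
  "concentrated k y \<theta> v x \<longleftrightarrow>
     \<bar>\<Sum>s\<in>block k. y s - \<theta>\<bar> \<le> 2 * sqrt (2 ^ k * v * x) + 2 * x \<and>
     \<bar>\<Sum>s\<in>block k. y s - \<theta>\<bar> \<le> 2 ^ k \<and>
     2 ^ k * v / 2 - x \<le> (\<Sum>s\<in>block k. (y s - \<theta>)\<^sup>2) \<and>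
     (\<Sum>s\<in>block k. (y s - \<theta>)\<^sup>2) \<le> 2 * 2 ^ k * v + x"

lemma card_block [simp]: "card (block k) = 2 ^ k"
  by (simp add: block_def)

lemma finite_block [simp]: "finite (block k)"
  by (simp add: block_def)

section \<open>The reward tape as a product space with independent coordinates\<close>

definition tape :: "nat \<Rightarrow> (nat \<Rightarrow> real measure) \<Rightarrow> (nat \<times> nat \<Rightarrow> real) measure" where
  "tape n D = PiM ({..<n} \<times> UNIV) (\<lambda>p. D (fst p))"

locale bandit =
  fixes n :: nat and D :: "nat \<Rightarrow> real measure"
  assumes inst: "bandit_instance n D" and n_pos: "0 < n"
begin

lemma unit_distribution_arm: "i < n \<Longrightarrow> unit_distribution (D i)"
proof -
  assume "i < n"
  then interpret prob_space "D i" using inst by (simp add: bandit_instance_def)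
  have *: "sets (D i) = sets borel" "measure (D i) {0..1} = 1"
    using inst \<open>i < n\<close> by (auto simp: bandit_instance_def)
  then have "AE x in D i. x \<in> {0..1}"
    using prob_eq_1[of "{0..1}"] by simp
  then show ?thesis by unfold_locales (use * in auto)
qed

lemma prob_space_arm: "i < n \<Longrightarrow> prob_space (D i)"
  using inst by (simp add: bandit_instance_def)

sublocale prob_space "tape n D"
  unfolding tape_def by (rule prob_space_PiM) (auto simp: prob_space_arm)

lemma measurable_coordinate [measurable (raw)]:
  "i < n \<Longrightarrow> (\<lambda>\<omega>. \<omega> (i, s)) \<in> borel_measurable (tape n D)"
proof -
  assume i: "i < n"
  then have "(\<lambda>\<omega>. \<omega> (i, s)) \<in> measurable (tape n D) (D i)"
    unfolding tape_def using measurable_component_singleton[of "(i, s)" "{..<n} \<times> UNIV" "\<lambda>p. D (fst p)"] by simp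
  then show ?thesis
    using inst i by (simp add: bandit_instance_def cong: measurable_cong_sets)
qed

lemma distr_coordinate: "i < n \<Longrightarrow> distr (tape n D) (D i) (\<lambda>\<omega>. \<omega> (i, s)) = D i"
  unfolding tape_def
  using distr_PiM_component[of "{..<n} \<times> UNIV" "\<lambda>p. D (fst p)" "(i, s)"] prob_space_arm by auto

lemma indep_coordinates:
  "indep_vars (\<lambda>p. D (fst p)) (\<lambda>p \<omega>. \<omega> p) ({..<n} \<times> (UNIV :: nat set))"
proof (subst indep_vars_iff_distr_eq_PiM')
  show "{..<n} \<times> (UNIV :: nat set) \<noteq> {}" using n_pos by auto
  show meas: "random_variable (D (fst p)) (\<lambda>\<omega>. \<omega> p)" if "p \<in> {..<n} \<times> UNIV" for p :: "nat \<times> nat"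
    unfolding tape_def using measurable_component_singleton[OF that, of "\<lambda>p. D (fst p)"] by simp
  have "distr (tape n D) (\<Pi>\<^sub>M p\<in>{..<n} \<times> UNIV. D (fst p)) (\<lambda>\<omega>. \<lambda>p\<in>{..<n} \<times> UNIV. \<omega> p)
     = distr (tape n D) (tape n D) (\<lambda>\<omega>. \<omega>)"
    unfolding tape_def
    by (intro distr_cong) (auto simp: space_PiM PiE_def extensional_restrict)
  also have "\<dots> = tape n D" by (rule distr_id)
  also have "\<dots> = (\<Pi>\<^sub>M p\<in>{..<n} \<times> UNIV. distr (tape n D) (D (fst p)) (\<lambda>\<omega>. \<omega> p))"
    unfolding tape_def[of n D, THEN arg_cong, of "\<lambda>M. M = _"]
    by (intro PiM_cong) (use distr_coordinate in auto)
  finally show "distr (tape n D) (\<Pi>\<^sub>M p\<in>{..<n} \<times> UNIV. D (fst p)) (\<lambda>\<omega>. \<lambda>p\<in>{..<n} \<times> UNIV. \<omega> p)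
     = (\<Pi>\<^sub>M p\<in>{..<n} \<times> UNIV. distr (tape n D) (D (fst p)) (\<lambda>\<omega>. \<omega> p))" .
qed

lemma chernoff_block:
  assumes i: "i < n" and [measurable]: "f \<in> borel_measurable borel"
    and mgf: "(\<integral>\<^sup>+x. ennreal (exp (f x)) \<partial>D i) \<le> ennreal (exp c)"
  shows "emeasure (tape n D) {\<omega>\<in>space (tape n D). (\<Sum>s\<in>block k. f (\<omega> (i, s))) \<ge> 2 ^ k * c + x}
    \<le> ennreal (exp (- x))"
proof -
  have [measurable_cong]: "sets (D i) = sets borel"
    using inst i by (simp add: bandit_instance_def)
  let ?J = "Pair i ` block k"
  have "indep_vars (\<lambda>p. D (fst p)) (\<lambda>p \<omega>. \<omega> p) ?J"
    by (rule indep_vars_subset[OF indep_coordinates]) (use i in auto)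
  moreover have "f \<in> borel_measurable (D i)"
    using assms(2) inst i measurable_cong_sets[of "D i" borel borel borel] by (simp add: bandit_instance_def)
  ultimately have "indep_vars (\<lambda>_. borel) (\<lambda>p \<omega>. f (\<omega> p)) ?J"
    by (intro indep_vars_compose2[where X = "\<lambda>p \<omega>. \<omega> p" and Y = "\<lambda>_. f"]) auto
  moreover have "(\<integral>\<^sup>+\<omega>. ennreal (exp (f (\<omega> p))) \<partial>tape n D) \<le> ennreal (exp c)" if p: "p \<in> ?J" for p
  proof -
    obtain s where s: "p = (i, s)" using p by auto
    have "(\<lambda>\<omega>. \<omega> (i, s)) \<in> measurable (tape n D) (D i)"
      using measurable_coordinate[OF i] by (simp cong: measurable_cong_sets)
    then have "(\<integral>\<^sup>+\<omega>. ennreal (exp (f (\<omega> p))) \<partial>tape n D)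
      = (\<integral>\<^sup>+x. ennreal (exp (f x)) \<partial>distr (tape n D) (D i) (\<lambda>\<omega>. \<omega> (i, s)))"
      unfolding s by (subst nn_integral_distr) auto
    then show ?thesis using mgf by (simp add: distr_coordinate i)
  qed
  ultimately have "emeasure (tape n D) {\<omega>\<in>space (tape n D). (\<Sum>p\<in>?J. f (\<omega> p)) \<ge> real (card ?J) * c + x}
    \<le> ennreal (exp (- x))"
    by (intro chernoff_indep_sum) auto
  moreover have "inj_on (Pair i) (block k)" by (auto simp: inj_on_def)
  ultimately show ?thesis by (simp add: card_image sum.reindex)
qed

lemma AE_unit_tape: "i < n \<Longrightarrow> AE \<omega> in tape n D. 0 \<le> \<omega> (i, s) \<and> \<omega> (i, s) \<le> 1"
  unfolding tape_def
  using AE_PiM_component[of "{..<n} \<times> UNIV" "\<lambda>p. D (fst p)" "(i, s)" "\<lambda>x. 0 \<le> x \<and> x \<le> 1"]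
    prob_space_arm unit_distribution.AE_unit[OF unit_distribution_arm] by auto

lemma measurable_concentrated [measurable]:
  assumes [measurable]: "i < n"
  shows "Measurable.pred (tape n D) (\<lambda>\<omega>. concentrated k (\<lambda>s. \<omega> (i, s)) \<theta> v x)"
  unfolding concentrated_def by measurable

text \<open>Four one-sided Chernoff bounds, each failing with probability at most
  \<open>exp (- x)\<close>: two for the deviation and two for the sum of squares.\<close>

lemma prob_not_concentrated:
  assumes i: "i < n" and x: "0 \<le> x"
  shows "emeasure (tape n D)
      {\<omega>\<in>space (tape n D). \<not> concentrated k (\<lambda>s. \<omega> (i, s)) (mean (D i)) (var (D i)) x}
    \<le> ennreal (4 * exp (- x))"
proof -
  interpret U: unit_distribution "D i" by (rule unit_distribution_arm[OF i])
  note [measurable] = measurable_coordinate[OF i]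
  let ?T = "tape n D" and ?\<theta> = "mean (D i)" and ?v = "var (D i)" and ?N = "2 ^ k :: real"
  let ?S = "\<lambda>\<omega>. \<Sum>s\<in>block k. \<omega> (i, s) - ?\<theta>" and ?Y = "\<lambda>\<omega>. \<Sum>s\<in>block k. (\<omega> (i, s) - ?\<theta>)\<^sup>2"
  \<comment> \<open>The choice \<open>sqrt (x / (N * v))\<close>, with \<open>N = 2 ^ k\<close>,
    minimises the threshold \<open>(N * l\<^sup>2 * v + x) / l\<close>; it is capped at 1 because
    \<open>mgf_dev\<close> requires \<open>\<bar>l\<bar> \<le> 1\<close>.\<close>
  define l where "l = (if ?N * ?v \<le> x then 1 else sqrt (x / (?N * ?v)))"
  have l: "0 \<le> l" "l \<le> 1"
    using x by (auto simp: l_def divide_le_eq_1 not_le intro: divide_nonneg_nonneg)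
  have tail: "?N * (l\<^sup>2 * ?v) + x \<le> l * S" if S: "2 * sqrt (?N * ?v * x) + 2 * x < S" for S
  proof (cases "?N * ?v \<le> x")
    case True
    have "0 \<le> sqrt (?N * ?v * x)" using x U.var_bounds by simp
    then have "?N * ?v + x \<le> S" using S True by linarith
    then show ?thesis using True by (simp add: l_def)
  next
    case False
    then have nv: "0 < ?N * ?v" using x by linarith
    then have "?v \<noteq> 0" by auto
    have "l\<^sup>2 = x / (?N * ?v)" using False x nv by (simp add: l_def)
    then have "?N * (l\<^sup>2 * ?v) = x" using \<open>?v \<noteq> 0\<close> by (simp add: field_simps)
    moreover have "l * sqrt (?N * ?v * x) = x"
    proof -
      have "l * sqrt (?N * ?v * x) = sqrt (x / (?N * ?v) * (?N * ?v * x))"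
        using False by (simp only: l_def real_sqrt_mult if_False)
      also have "x / (?N * ?v) * (?N * ?v * x) = x\<^sup>2" using \<open>?v \<noteq> 0\<close> by (simp add: power2_eq_square)
      finally show ?thesis using x by simp
    qed
    moreover have "l * (2 * sqrt (?N * ?v * x) + 2 * x) \<le> l * S"
      using S l by (intro mult_left_mono) auto
    moreover have "l * (2 * sqrt (?N * ?v * x) + 2 * x) = 2 * (l * sqrt (?N * ?v * x)) + 2 * (l * x)"
      by (simp add: algebra_simps)
    moreover have "0 \<le> l * x" using x l by simp
    ultimately show ?thesis by linarith
  qed
  let ?A = "{\<omega>\<in>space ?T. (\<Sum>s\<in>block k. l * (\<omega> (i, s) - ?\<theta>)) \<ge> 2 ^ k * (l\<^sup>2 * ?v) + x}"
  let ?B = "{\<omega>\<in>space ?T. (\<Sum>s\<in>block k. (- l) * (\<omega> (i, s) - ?\<theta>)) \<ge> 2 ^ k * ((- l)\<^sup>2 * ?v) + x}"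
  let ?C = "{\<omega>\<in>space ?T. (\<Sum>s\<in>block k. - (\<omega> (i, s) - ?\<theta>)\<^sup>2) \<ge> 2 ^ k * (- (1/2) * ?v) + x}"
  let ?E = "{\<omega>\<in>space ?T. (\<Sum>s\<in>block k. (\<omega> (i, s) - ?\<theta>)\<^sup>2) \<ge> 2 ^ k * (2 * ?v) + x}"
  have bounds: "emeasure ?T ?A \<le> ennreal (exp (- x))" "emeasure ?T ?B \<le> ennreal (exp (- x))"
      "emeasure ?T ?C \<le> ennreal (exp (- x))" "emeasure ?T ?E \<le> ennreal (exp (- x))"
    using l by (intro chernoff_block i; simp add: U.mgf_dev U.mgf_sq_dev
      U.mgf_dev[of "- l", simplified] U.mgf_minus_sq_dev[simplified])+
  have "AE \<omega> in ?T. \<forall>s\<in>block k. 0 \<le> \<omega> (i, s) \<and> \<omega> (i, s) \<le> 1"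
    by (intro AE_finite_allI AE_unit_tape i) simp
  note unit = this
  have "emeasure ?T {\<omega>\<in>space ?T. \<not> concentrated k (\<lambda>s. \<omega> (i, s)) ?\<theta> ?v x}
      \<le> emeasure ?T (?A \<union> ?B \<union> ?C \<union> ?E)"
  proof (intro emeasure_mono_AE)
    have "\<omega> \<in> ?A \<union> ?B \<union> ?C \<union> ?E"
      if \<omega>: "\<omega> \<in> space ?T" "\<not> concentrated k (\<lambda>s. \<omega> (i, s)) ?\<theta> ?v x"
        and unit: "\<forall>s\<in>block k. 0 \<le> \<omega> (i, s) \<and> \<omega> (i, s) \<le> 1" for \<omega>
    proof -
      have "\<bar>?S \<omega>\<bar> \<le> (\<Sum>s\<in>block k. \<bar>\<omega> (i, s) - ?\<theta>\<bar>)" by (rule sum_abs)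
      also have "\<dots> \<le> (\<Sum>s\<in>block k. 1)" by (intro sum_mono U.dev_bounds) (use unit in auto)
      finally have "\<bar>?S \<omega>\<bar> \<le> 2 ^ k" by simp
      then consider "2 * sqrt (2 ^ k * ?v * x) + 2 * x < ?S \<omega>" | "2 * sqrt (2 ^ k * ?v * x) + 2 * x < - ?S \<omega>"
        | "?Y \<omega> < 2 ^ k * ?v / 2 - x" | "2 * 2 ^ k * ?v + x < ?Y \<omega>"
        using \<omega>(2) by (auto simp: concentrated_def not_le abs_if split: if_splits)
      then show ?thesis
      proof cases
        case 1 then show ?thesis using tail[OF 1] \<omega>(1) by (simp add: sum_distrib_left)
      next
        case 2 then show ?thesis using tail[OF 2] \<omega>(1) by (simp add: sum_distrib_left sum_negf)
      next
        case 3 then show ?thesis using \<omega>(1) by (simp add: sum_negf)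
      next
        case 4 then show ?thesis using \<omega>(1) by simp
      qed
    qed
    note * = this
    show "AE \<omega> in ?T. \<omega> \<in> {\<omega>\<in>space ?T. \<not> concentrated k (\<lambda>s. \<omega> (i, s)) ?\<theta> ?v x}
        \<longrightarrow> \<omega> \<in> ?A \<union> ?B \<union> ?C \<union> ?E"
      using unit
    proof (rule AE_mp, intro AE_I2 impI)
      fix \<omega> assume "\<omega> \<in> {\<omega>\<in>space ?T. \<not> concentrated k (\<lambda>s. \<omega> (i, s)) ?\<theta> ?v x}"
        "\<forall>s\<in>block k. 0 \<le> \<omega> (i, s) \<and> \<omega> (i, s) \<le> 1"
      then show "\<omega> \<in> ?A \<union> ?B \<union> ?C \<union> ?E" by (intro *) simp_all
    qed
  qed measurable
  also have "\<dots> \<le> emeasure ?T ?A + emeasure ?T ?B + emeasure ?T ?C + emeasure ?T ?E"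
    by (intro order_trans[OF emeasure_subadditive] add_mono order_refl) measurable
  also have "\<dots> \<le> ennreal (exp (- x)) + ennreal (exp (- x)) + ennreal (exp (- x)) + ennreal (exp (- x))"
    by (intro add_mono bounds)
  also have "\<dots> = ennreal (4 * exp (- x))"
    by (simp add: ennreal_plus[symmetric] del: ennreal_plus)
  finally show ?thesis .
qed

end

section \<open>Empirical confidence radii\<close>

lemma block_mean_diff: "2 ^ k * (block_mean k y - \<theta>) = (\<Sum>s\<in>block k. y s - \<theta>)"
  by (simp add: block_mean_def sum_subtractf algebra_simps)

lemma block_dev_eq:
  "block_dev k y = (\<Sum>s\<in>block k. (y s - \<theta>)\<^sup>2) - (\<Sum>s\<in>block k. y s - \<theta>)\<^sup>2 / 2 ^ k"
proof -
  let ?m = "block_mean k y - \<theta>"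
  have "(y s - block_mean k y)\<^sup>2 = (y s - \<theta>)\<^sup>2 - 2 * ?m * (y s - \<theta>) + ?m\<^sup>2" for s
    by (simp add: power2_eq_square algebra_simps)
  then have "block_dev k y = (\<Sum>s\<in>block k. (y s - \<theta>)\<^sup>2) - 2 * ?m * (\<Sum>s\<in>block k. y s - \<theta>) + 2 ^ k * ?m\<^sup>2"
    unfolding block_dev_def by (simp only: sum.distrib sum_subtractf sum_distrib_left[symmetric]) simp
  also have "\<dots> = (\<Sum>s\<in>block k. (y s - \<theta>)\<^sup>2) - (\<Sum>s\<in>block k. y s - \<theta>)\<^sup>2 / 2 ^ k"
    by (simp add: block_mean_diff[symmetric] power2_eq_square field_simps)
  finally show ?thesis .
qed

lemma block_dev_nonneg: "0 \<le> block_dev k y"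
  by (simp add: block_dev_def sum_nonneg)

lemma radius_nonneg: "0 \<le> x \<Longrightarrow> 0 \<le> radius k y x"
  by (simp add: radius_def block_dev_nonneg)

lemma radius_mono: "0 \<le> x \<Longrightarrow> x \<le> x' \<Longrightarrow> radius k y x \<le> radius k y x'"
  unfolding radius_def
  by (intro divide_right_mono add_mono mult_left_mono real_sqrt_le_mono) (auto simp: block_dev_nonneg)

text \<open>The unknown variance in Bernstein's bound is traded for the empirical one: the lower
  bound on the sum of squares yields \<open>w \<le> 4 * V + 44 * x\<close>, and inserting this costs
  only constants.\<close>

lemma concentrated_imp_le_radius:
  assumes c: "concentrated k y \<theta> v x" and "0 \<le> v" "0 \<le> x"
  shows "\<bar>block_mean k y - \<theta>\<bar> \<le> radius k y x"
proof -
  define S where "S = (\<Sum>s\<in>block k. y s - \<theta>)"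
  define Y where "Y = (\<Sum>s\<in>block k. (y s - \<theta>)\<^sup>2)"
  define w where "w = 2 ^ k * v"
  define V where "V = block_dev k y"
  have w: "0 \<le> w" using assms by (simp add: w_def)
  have V: "0 \<le> V" by (simp add: V_def block_dev_nonneg)
  have c': "\<bar>S\<bar> \<le> 2 * sqrt (w * x) + 2 * x" "\<bar>S\<bar> \<le> 2 ^ k" "w / 2 - x \<le> Y"
    using c by (auto simp: concentrated_def S_def Y_def w_def)
  have "S\<^sup>2 / 2 ^ k \<le> \<bar>S\<bar>"
  proof -
    have "S\<^sup>2 = \<bar>S\<bar> * \<bar>S\<bar>" by (simp add: power2_eq_square abs_mult[symmetric])
    also have "\<dots> \<le> \<bar>S\<bar> * 2 ^ k" by (intro mult_left_mono c') simp
    finally show ?thesis by (simp add: divide_le_eq)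
  qed
  moreover have "Y = V + S\<^sup>2 / 2 ^ k"
    by (simp add: V_def Y_def S_def block_dev_eq[of k y \<theta>])
  ultimately have "w / 2 \<le> V + 2 * sqrt (w * x) + 3 * x" using c' by linarith
  \<comment> \<open>The weights are chosen so that the mixed term \<open>2 * sqrt (w * x)\<close>
    costs only \<open>w / 8\<close> of the \<open>w / 2\<close> on the left.\<close>
  moreover have "sqrt (w / 8 * (8 * x)) \<le> (w / 8 + 8 * x) / 2"
    by (rule arith_geo_mean_sqrt) (use w assms in auto)
  ultimately have "w \<le> 4 * V + 44 * x" using V assms(3) by simp
  then have "w * x \<le> (4 * V + 44 * x) * x"
    using assms by (intro mult_right_mono) auto
  then have "sqrt (w * x) \<le> sqrt (4 * (V * x) + 44 * x\<^sup>2)"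
    by (intro real_sqrt_le_mono) (simp add: algebra_simps power2_eq_square)
  also have "\<dots> \<le> sqrt (4 * (V * x)) + sqrt (44 * x\<^sup>2)"
    by (rule sqrt_add_le_add_sqrt) (use V assms in auto)
  also have "sqrt (44 * x\<^sup>2) \<le> sqrt (49 * x\<^sup>2)" by simp
  also have "\<dots> = 7 * x" using assms by (simp add: real_sqrt_mult)
  finally have "2 * sqrt (w * x) + 2 * x \<le> 4 * sqrt (V * x) + 16 * x"
    by (simp add: real_sqrt_mult)
  then have "\<bar>S\<bar> \<le> 4 * sqrt (V * x) + 16 * x" using c'(1) by linarith
  moreover have "2 ^ k * \<bar>block_mean k y - \<theta>\<bar> = \<bar>S\<bar>"
    unfolding S_def block_mean_diff[symmetric] by (simp add: abs_mult)
  ultimately show ?thesis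
    by (simp add: radius_def V_def[symmetric] pos_le_divide_eq mult.commute)
qed

text \<open>A bound for three radii plus one deviation, all taken at levels at most \<open>X\<close>.\<close>

definition width :: "nat \<Rightarrow> real \<Rightarrow> real \<Rightarrow> real" where
  "width k v X = (19 * sqrt (2 ^ k * v * X) + 62 * X) / 2 ^ k"

text \<open>The levels of the radius and of the concentration are kept apart: the radius of a
  suboptimal arm is computed at the base level, while its concentration may hold only at a higher
  one.\<close>

lemma concentrated_width:
  assumes c: "concentrated k y \<theta> v z" and "0 \<le> v" "0 \<le> x" "x \<le> X" "0 \<le> z" "z \<le> X"
  shows "\<bar>block_mean k y - \<theta>\<bar> + 3 * radius k y x \<le> width k v X"
proof -
  define S where "S = (\<Sum>s\<in>block k. y s - \<theta>)"
  define w where "w = 2 ^ k * v"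
  have w: "0 \<le> w" using assms by (simp add: w_def)
  have X: "0 \<le> X" using assms by simp
  have "sqrt (w * z) \<le> sqrt (w * X)"
    using w assms by (intro real_sqrt_le_mono mult_left_mono) auto
  then have S: "\<bar>S\<bar> \<le> 2 * sqrt (w * X) + 2 * X"
    using c assms(5,6) unfolding concentrated_def S_def w_def by linarith
  have "block_dev k y \<le> (\<Sum>s\<in>block k. (y s - \<theta>)\<^sup>2)"
    unfolding block_dev_eq[of k y \<theta>] by simp
  also have "\<dots> \<le> 2 * w + X"
    using c assms by (auto simp: concentrated_def w_def)
  finally have "block_dev k y * x \<le> (2 * w + X) * X"
    using assms w X by (intro mult_mono) auto
  then have "sqrt (block_dev k y * x) \<le> sqrt (2 * (w * X) + X\<^sup>2)"
    by (intro real_sqrt_le_mono) (simp add: algebra_simps power2_eq_square)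
  also have "\<dots> \<le> sqrt (2 * (w * X)) + sqrt (X\<^sup>2)"
    by (rule sqrt_add_le_add_sqrt) (use w X in auto)
  \<comment> \<open>\<open>17 / 12\<close> is a rational upper bound of sqrt 2; the constants of
    \<open>width\<close> are \<open>3 * 4 * 17 / 12 + 2 = 19\<close> and
    \<open>3 * (4 + 16) + 2 = 62\<close>.\<close>
  also have "sqrt (2 * (w * X)) \<le> sqrt ((17/12)\<^sup>2 * (w * X))"
    using w X by (intro real_sqrt_le_mono mult_right_mono) (auto simp: power2_eq_square)
  also have "\<dots> = 17 / 12 * sqrt (w * X)" by (simp add: real_sqrt_mult)
  finally have "sqrt (block_dev k y * x) \<le> 17 / 12 * sqrt (w * X) + X" using X by simp
  then have "\<bar>S\<bar> + 3 * (4 * sqrt (block_dev k y * x) + 16 * x) \<le> 19 * sqrt (w * X) + 62 * X"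
    using S assms by argo
  then have "(\<bar>S\<bar> + 3 * (4 * sqrt (block_dev k y * x) + 16 * x)) / 2 ^ k \<le> width k v X"
    unfolding width_def w_def by (intro divide_right_mono) auto
  moreover have "2 ^ k * \<bar>block_mean k y - \<theta>\<bar> = \<bar>S\<bar>"
    unfolding S_def block_mean_diff[symmetric] by (simp add: abs_mult)
  then have "\<bar>block_mean k y - \<theta>\<bar> = \<bar>S\<bar> / 2 ^ k" by (simp add: field_simps)
  ultimately show ?thesis
    by (simp add: radius_def add_divide_distrib)
qed

text \<open>Inverts the width: a block that does not yet resolve half the gap is short. The variance
  term contributes \<open>v / d\<^sup>2\<close>, the linear term \<open>1 / d\<close>.\<close>

lemma width_ge_imp_le:
  assumes d: "0 < d" "d \<le> 2 * width k v X" and v: "0 \<le> v" and X: "0 \<le> X"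
  shows "2 ^ k \<le> 5776 * (v / d\<^sup>2 + 1 / d) * X"
proof -
  let ?N = "2 ^ k :: real"
  have *: "?N * d \<le> 38 * sqrt (?N * v * X) + 124 * X"
    using d by (simp add: width_def field_simps)
  have nonneg: "0 \<le> v / d\<^sup>2 * X" "0 \<le> 1 / d * X" using assms by auto
  show ?thesis
  \<comment> \<open>Either the linear term makes up at least half of the left-hand side, or it can
    be absorbed there; squaring the rest then produces \<open>76\<^sup>2 = 5776\<close>.\<close>
  proof (cases "?N * d \<le> 248 * X")
    case True
    then have "?N \<le> 248 * (1 / d * X)" using d by (simp add: field_simps)
    then have "?N \<le> 5776 * (v / d\<^sup>2 * X) + 5776 * (1 / d * X)" using nonneg by linarith
    then show ?thesis by (simp only: distrib_left distrib_right mult.assoc)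
  next
    case False
    then have "?N * d \<le> 76 * sqrt (?N * v * X)" using * by simp
    then have "(?N * d)\<^sup>2 \<le> (76 * sqrt (?N * v * X))\<^sup>2"
      using d by (intro power_mono) auto
    then have "?N * (?N * d\<^sup>2) \<le> ?N * (5776 * (v * X))"
      using v X by (simp add: power_mult_distrib power2_eq_square mult_ac)
    then have "?N * d\<^sup>2 \<le> 5776 * (v * X)" by simp
    then have "?N \<le> 5776 * (v / d\<^sup>2 * X)" using d by (simp add: field_simps)
    then have "?N \<le> 5776 * (v / d\<^sup>2 * X) + 5776 * (1 / d * X)" using nonneg by linarith
    then show ?thesis by (simp only: distrib_left distrib_right mult.assoc)
  qed
qed

lemma LL_ge_one: "0 < d \<Longrightarrow> d \<le> 1 \<Longrightarrow> 1 \<le> LL (1 / d)"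
proof -
  assume "0 < d" "d \<le> 1"
  then have "ln (exp 1) \<le> LL (1 / d)" unfolding LL_def
    by (subst ln_le_cancel_iff) (auto intro: add_pos_nonneg)
  then show ?thesis by simp
qed

lemma ln_le_numeral:
  assumes "0 < (x::real)" "x \<le> 2 ^ m"
  shows "ln x \<le> real m"
proof -
  have "(2::real) ^ m \<le> exp 1 ^ m"
    using exp_ge_add_one_self[of 1] by (intro power_mono) auto
  then have "x \<le> exp (real m)" using assms by (simp add: exp_of_nat_mult[symmetric])
  then show ?thesis using assms by (metis ln_exp ln_le_cancel_iff exp_gt_zero)
qed

text \<open>Removes the \<open>ln k\<close> on the right-hand side: since \<open>2 ^ k\<close> is at most polynomial in \<open>1/d\<close>,
  \<open>Q\<close> and \<open>k\<close>, the number \<open>k\<close> is of the order \<open>ln (1/d) + ln Q\<close>.\<close>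

lemma block_length_le:
  assumes d: "0 < d" "d \<le> 1" and v: "0 \<le> v" "v \<le> 1" and Q: "1 \<le> Q"
    and le: "2 ^ k \<le> 5776 * (v / d\<^sup>2 + 1 / d) * (Q + 2 * ln (real k + 2))"
  shows "2 ^ k \<le> 75088 * (v / d\<^sup>2 + 1 / d) * (Q + LL (1 / d))"
proof -
  define L where "L = ln (1 / d)"
  have L: "0 \<le> L" using d by (simp add: L_def)
  \<comment> \<open>A crude polynomial bound is enough here, since only its logarithm is
    used.\<close>
  have "v / d\<^sup>2 \<le> 1 / d\<^sup>2" using v by (intro divide_right_mono) auto
  moreover have "1 / d \<le> 1 / d\<^sup>2"
    using d by (simp add: field_simps power2_eq_square)
  ultimately have H: "v / d\<^sup>2 + 1 / d \<le> 2 / d\<^sup>2" by simp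
  have H0: "0 \<le> v / d\<^sup>2 + 1 / d" using d v by simp
  have lnk0: "0 \<le> ln (real k + 2)" by simp
  have "ln (real k + 2) \<le> real k + 1" using ln_le_minus_one[of "real k + 2"] by simp
  moreover have "2 * ln (real k + 2) * 1 \<le> 2 * ln (real k + 2) * Q"
    by (rule mult_left_mono) (use Q in auto)
  ultimately have "Q + 2 * ln (real k + 2) \<le> Q + 2 * (real k + 1) * Q"
    using Q by (smt (verit) mult_right_mono)
  also have "\<dots> = Q * (2 * real k + 3)" by (simp add: algebra_simps)
  finally have X: "Q + 2 * ln (real k + 2) \<le> Q * (2 * real k + 3)" .
  have "2 ^ k \<le> 5776 * (2 / d\<^sup>2) * (Q * (2 * real k + 3))"
    by (rule order_trans[OF le], intro mult_mono) (use H H0 X Q in auto)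
  also have "\<dots> = 11552 * (1 / d)\<^sup>2 * Q * (2 * real k + 3)"
    by (simp add: power_divide)
  finally have "ln (2 ^ k) \<le> ln (11552 * (1 / d)\<^sup>2 * Q * (2 * real k + 3))"
    using Q d by (subst ln_le_cancel_iff) auto
  also have "\<dots> = ln 11552 + 2 * L + ln Q + ln (2 * real k + 3)"
    using Q d by (simp add: ln_mult ln_realpow L_def)
  finally have "real k * ln 2 \<le> ln 11552 + 2 * L + ln Q + ln (2 * real k + 3)"
    by (simp add: ln_realpow)
  moreover have "real k * (2 / 3) \<le> real k * ln 2"
    by (intro mult_left_mono ln2_ge_two_thirds) auto
  moreover have "ln (11552::real) \<le> 14" using ln_le_numeral[of 11552 14] by simp
  \<comment> \<open>Splitting off the factor 8 gives slope \<open>1 / 4\<close> in \<open>k\<close>,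
    below the slope \<open>2 / 3\<close> coming from \<open>ln 2\<close>, so that \<open>k\<close>
    can be isolated.\<close>
  moreover have "ln (2 * real k + 3) \<le> (2 * real k + 3) / 8 + 2"
  proof -
    have "ln ((2 * real k + 3) / 8) \<le> (2 * real k + 3) / 8 - 1"
      by (rule ln_le_minus_one) simp
    moreover have "ln (8::real) \<le> 3" using ln_le_numeral[of 8 3] by simp
    ultimately show ?thesis by (simp add: ln_div)
  qed
  moreover have "ln Q \<le> Q - 1" using ln_le_minus_one[of Q] Q by simp
  moreover have "y \<le> 40 + 5 * L + 3 * (Q - 1)"
    if "a \<le> b + 2 * L + c + e" "y * (2 / 3) \<le> a" "b \<le> 14" "e \<le> (2 * y + 3) / 8 + 2" "c \<le> Q - 1"
    for a b c e y :: real
    using that L Q by (simp add: field_simps)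
  ultimately have "real k \<le> 40 + 5 * L + 3 * (Q - 1)" by blast
  also have "\<dots> + 2 \<le> 42 * (1 + L) * Q"
  proof -
    have "0 \<le> L * (Q - 1)" using L Q by simp
    then show ?thesis using L Q by (simp add: algebra_simps)
  qed
  also have "\<dots> \<le> 42 * (exp 1 + L) * Q"
    using Q by (intro mult_right_mono mult_left_mono add_right_mono) (auto intro: order_trans[OF _ exp_ge_add_one_self])
  finally have "ln (real k + 2) \<le> ln (42 * (exp 1 + L) * Q)"
    using Q L by (subst ln_le_cancel_iff) (auto intro: add_pos_nonneg mult_pos_pos)
  also have "\<dots> = ln 42 + LL (1 / d) + ln Q"
  proof -
    have "0 < exp 1 + L" using L by (simp add: add_pos_nonneg)
    then have "ln (42 * ((exp 1 + L) * Q)) = ln 42 + (ln (exp 1 + L) + ln Q)"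
      using Q by (simp add: ln_mult_pos del: distrib_right distrib_left)
    then show ?thesis by (simp only: LL_def L_def mult.assoc add.assoc)
  qed
  also have "\<dots> \<le> 6 + LL (1 / d) + (Q - 1)"
    using ln_le_numeral[of 42 6] ln_le_minus_one[of Q] Q by simp
  \<comment> \<open>Additive constants are absorbed because \<open>Q\<close> and
    \<open>LL (1 / d)\<close> are at least 1; \<open>5776 * 13 = 75088\<close>.\<close>
  finally have "Q + 2 * ln (real k + 2) \<le> 13 * (Q + LL (1 / d))"
    using LL_ge_one[OF d] Q by simp
  then have "5776 * (v / d\<^sup>2 + 1 / d) * (Q + 2 * ln (real k + 2))
      \<le> 5776 * (v / d\<^sup>2 + 1 / d) * (13 * (Q + LL (1 / d)))"
    using H0 by (intro mult_left_mono) auto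
  also have "\<dots> = 75088 * (v / d\<^sup>2 + 1 / d) * (Q + LL (1 / d))"
    by algebra
  finally show ?thesis using le by linarith
qed

section \<open>The policy\<close>

definition observations :: "(nat \<times> real) list \<Rightarrow> nat \<Rightarrow> nat \<Rightarrow> real" where
  "observations h i s = map snd (filter (\<lambda>p. fst p = i) h) ! s"

text \<open>The increment turns \<open>exp (- q)\<close> into
  \<open>exp (- q) / (k + 2)\<^sup>2\<close>, so that a union bound over all blocks of an arm costs
  only a constant factor.\<close>

definition level :: "real \<Rightarrow> nat \<Rightarrow> real" where
  "level q k = q + 2 * ln (real k + 2)"

text \<open>With \<open>T \<ge> 2\<close> samples, \<open>block (block_index T)\<close> is the last block that has been observed
  completely.\<close>

definition block_index :: "nat \<Rightarrow> nat" where
  "block_index T = floor_log (T div 2)"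

text \<open>The policy must read this time off the history: as long as it has not stopped,
  \<open>take l h\<close> is its history at time \<open>l\<close>.\<close>

definition hit :: "(nat \<times> real) list \<Rightarrow> nat \<Rightarrow> nat \<Rightarrow> nat" where
  "hit h i N = (LEAST l. pulls (take l h) i = N)"

text \<open>The level of the lower confidence bound of an arm grows with the total number \<open>t\<close> of samples at
  the time when the block was entered: \<open>(2 ^ k / t)\<^sup>2\<close> is summable over the arms.\<close>

definition strict_level :: "real \<Rightarrow> nat \<Rightarrow> nat \<Rightarrow> real" where
  "strict_level q k t = level q k + 2 * ln (real t / 2 ^ k)"

definition leader :: "nat \<Rightarrow> (nat \<Rightarrow> real) \<Rightarrow> nat" where
  "leader n U = (LEAST i. i < n \<and> (\<forall>j<n. U j \<le> U i))"

definition runner_up :: "nat \<Rightarrow> (nat \<Rightarrow> real) \<Rightarrow> nat" where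
  "runner_up n U = (LEAST i. i < n \<and> i \<noteq> leader n U \<and> (\<forall>j<n. j \<noteq> leader n U \<longrightarrow> U j \<le> U i))"

text \<open>The predicate \<open>heavy\<close> will mark an arm holding more than half of all samples. Without it, a rival
  that is cheap to sample but has an unlucky estimate could force many samples of an expensive best arm.\<close>

definition decide ::
  "nat \<Rightarrow> (nat \<Rightarrow> real) \<Rightarrow> (nat \<Rightarrow> real) \<Rightarrow> (nat \<Rightarrow> real) \<Rightarrow> (nat \<Rightarrow> bool) \<Rightarrow> action" where
  "decide n m r r' heavy =
    (let U = (\<lambda>i. m i + r i); h = leader n U; l = runner_up n U in
     if U l < m h - r' h then Stop h
     else if r l < r' h then (if heavy h then Pull l else Pull h)
     else (if heavy l then Pull h else Pull l))"

text \<open>Two initial pulls per arm are required because \<open>block 0\<close> consists of the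
  index 1 alone. The strict level refers to the time at which the block was entered, not to the
  current time.\<close>

definition policy :: "nat \<Rightarrow> real \<Rightarrow> policy" where
  "policy n q u h =
    (if \<exists>i<n. pulls h i < 2 then Pull (LEAST i. i < n \<and> pulls h i < 2)
     else
       let k = (\<lambda>i. block_index (pulls h i)); y = observations h in
       decide n (\<lambda>i. block_mean (k i) (y i)) (\<lambda>i. radius (k i) (y i) (level q (k i)))
         (\<lambda>i. radius (k i) (y i) (strict_level q (k i) (hit h i (2 ^ k i))))
         (\<lambda>i. length h < 2 * pulls h i))"

lemma finite_has_maximum:
  fixes U :: "'a \<Rightarrow> real"
  assumes "finite A" "A \<noteq> {}"
  shows "\<exists>i\<in>A. \<forall>j\<in>A. U j \<le> U i"
proof -
  have "Max (U ` A) \<in> U ` A" using assms by simp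
  then obtain i where "i \<in> A" "U i = Max (U ` A)" by auto
  then show ?thesis using assms by (metis Max_ge finite_imageI image_eqI)
qed

lemma leader_props:
  assumes "0 < n"
  shows "leader n U < n" "j < n \<Longrightarrow> U j \<le> U (leader n U)"
proof -
  have "\<exists>i. i < n \<and> (\<forall>j<n. U j \<le> U i)"
    using assms finite_has_maximum[of "{..<n}" U] by auto
  from LeastI_ex[OF this] show "leader n U < n" "j < n \<Longrightarrow> U j \<le> U (leader n U)"
    by (auto simp: leader_def)
qed

lemma runner_up_props:
  assumes "2 \<le> n"
  shows "runner_up n U < n" "runner_up n U \<noteq> leader n U"
    "j < n \<Longrightarrow> j \<noteq> leader n U \<Longrightarrow> U j \<le> U (runner_up n U)"
proof -
  let ?A = "{..<n} - {leader n U}"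
  have "card ?A \<noteq> 0" using assms leader_props(1)[of n U] by simp
  then have "?A \<noteq> {}" by (metis card.empty)
  then have "\<exists>i. i < n \<and> i \<noteq> leader n U \<and> (\<forall>j<n. j \<noteq> leader n U \<longrightarrow> U j \<le> U i)"
    using finite_has_maximum[of ?A U] by auto
  from LeastI_ex[OF this] show "runner_up n U < n" "runner_up n U \<noteq> leader n U"
    "j < n \<Longrightarrow> j \<noteq> leader n U \<Longrightarrow> U j \<le> U (runner_up n U)"
    by (auto simp: runner_up_def)
qed

lemma leader_cong: "(\<And>i. i < n \<Longrightarrow> U i = U' i) \<Longrightarrow> leader n U = leader n U'"
  unfolding leader_def by (intro arg_cong[where f = Least] ext) auto

lemma runner_up_cong: "(\<And>i. i < n \<Longrightarrow> U i = U' i) \<Longrightarrow> runner_up n U = runner_up n U'"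
  unfolding runner_up_def using leader_cong[of n U U'] by (intro arg_cong[where f = Least] ext) auto

lemma decide_cong:
  assumes "2 \<le> n" "\<And>i. i < n \<Longrightarrow> m i = m' i" "\<And>i. i < n \<Longrightarrow> r i = r' i" "\<And>i. i < n \<Longrightarrow> s i = s' i"
  shows "decide n m r s heavy = decide n m' r' s' heavy"
proof -
  have "leader n (\<lambda>i. m i + r i) = leader n (\<lambda>i. m' i + r' i)"
    "runner_up n (\<lambda>i. m i + r i) = runner_up n (\<lambda>i. m' i + r' i)"
    by (intro leader_cong runner_up_cong; simp add: assms)+
  moreover have "leader n (\<lambda>i. m' i + r' i) < n" "runner_up n (\<lambda>i. m' i + r' i) < n"
    using assms(1) by (auto intro: leader_props runner_up_props)
  ultimately show ?thesis by (simp add: decide_def Let_def assms)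
qed

lemma valid_policy_policy: "2 \<le> n \<Longrightarrow> valid_policy n (policy n q)"
proof -
  assume n: "2 \<le> n"
  have *: "(LEAST i. i < n \<and> pulls h i < 2) < n" if "\<exists>i<n. pulls h i < 2" for h
    using LeastI_ex[OF that] by simp
  have "leader n U < n" "runner_up n U < n" for U
    using n by (auto intro: leader_props runner_up_props)
  then show ?thesis
    by (auto simp: valid_policy_def policy_def decide_def Let_def * split: if_splits)
qed

section \<open>Histories and their reconstruction from the sequence of pulled arms\<close>

lemma history_0 [simp]: "history A u x 0 = []"
  by (simp add: history_def)

lemma history_Suc: "history A u x (Suc t) = step A u x (history A u x t)"
  by (simp add: history_def)

lemma pulls_Nil [simp]: "pulls [] i = 0"
  by (simp add: pulls_def)

lemma pulls_snoc [simp]: "pulls (h @ [(j, z)]) i = pulls h i + (if j = i then 1 else 0)"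
  by (simp add: pulls_def)

lemma pulls_le_length: "pulls h i \<le> length h"
  by (simp add: pulls_def)

text \<open>Separates the discrete part of a history from the real one: there are only countably
  many arm sequences, and for a fixed sequence each observation is a tape coordinate. Measurability
  is reduced to this case.\<close>

definition replay :: "(nat \<times> nat \<Rightarrow> real) \<Rightarrow> nat list \<Rightarrow> (nat \<times> real) list" where
  "replay x a = map (\<lambda>l. (a ! l, x (a ! l, count_list (take l a) (a ! l)))) [0..<length a]"

lemma replay_Nil [simp]: "replay x [] = []"
  by (simp add: replay_def)

lemma replay_snoc [simp]: "replay x (a @ [i]) = replay x a @ [(i, x (i, count_list a i))]"
  by (simp add: replay_def nth_append)

lemma length_replay [simp]: "length (replay x a) = length a"
  by (simp add: replay_def)

lemma map_fst_replay [simp]: "map fst (replay x a) = a"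
  by (rule nth_equalityI) (simp_all add: replay_def)

lemma take_replay: "take l (replay x a) = replay x (take l a)"
proof (rule nth_equalityI)
  fix i assume "i < length (take l (replay x a))"
  then have "i < l" "i < length a" by simp_all
  then show "take l (replay x a) ! i = replay x (take l a) ! i" by (simp add: replay_def min_def)
qed simp

lemma filter_replay:
  "map snd (filter (\<lambda>p. fst p = i) (replay x a)) = map (\<lambda>s. x (i, s)) [0..<count_list a i]"
  by (induction a rule: rev_induct) auto

lemma pulls_replay: "pulls (replay x a) i = count_list a i"
  using filter_replay[of i x a, THEN arg_cong, of length] by (simp add: pulls_def)

lemma observations_replay: "s < count_list a i \<Longrightarrow> observations (replay x a) i s = x (i, s)"
  by (simp add: observations_def filter_replay)

lemma hit_replay: "hit (replay x a) i N = (LEAST l. count_list (take l a) i = N)"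
  by (simp add: hit_def take_replay pulls_replay)

lemma step_replay:
  "step A u x (replay x a) = (case A u (replay x a) of Pull i \<Rightarrow> replay x (a @ [i]) | Stop j \<Rightarrow> replay x a)"
  by (simp add: step_def pulls_replay split: action.splits)

lemma history_replay: "history A u x t = replay x (map fst (history A u x t))"
proof (induction t)
  case (Suc t)
  define a where "a = map fst (history A u x t)"
  have "history A u x (Suc t) = step A u x (replay x a)"
    using Suc by (simp add: history_Suc a_def)
  then show ?case
    by (simp add: step_replay del: replay_snoc split: action.splits)
qed simp

lemma block_stats_cong:
  assumes "\<And>s. s \<in> block k \<Longrightarrow> y s = y' s"
  shows "block_mean k y = block_mean k y'" "radius k y z = radius k y' z"
    "concentrated k y \<theta> v z = concentrated k y' \<theta> v z"
proof -
  show *: "block_mean k y = block_mean k y'"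
    using assms by (simp add: block_mean_def cong: sum.cong)
  show "radius k y z = radius k y' z"
    using assms by (simp add: radius_def block_dev_def * cong: sum.cong)
  show "concentrated k y \<theta> v z = concentrated k y' \<theta> v z"
    using assms by (simp add: concentrated_def cong: sum.cong)
qed

lemma block_index_bounds:
  assumes "2 \<le> T"
  shows "2 * 2 ^ block_index T \<le> T" "T < 4 * 2 ^ block_index T"
proof -
  have "2 ^ block_index T \<le> T div 2" "T div 2 < 2 * 2 ^ block_index T"
    unfolding block_index_def using floor_log_exp2_le[of "T div 2"] floor_log_exp2_gt[of "T div 2"] assms by auto
  then show "2 * 2 ^ block_index T \<le> T" "T < 4 * 2 ^ block_index T" by linarith+
qed

lemma block_stats_replay:
  assumes "2 \<le> count_list a i" and k: "k = block_index (count_list a i)"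
  shows "block_mean k (observations (replay x a) i) = block_mean k (\<lambda>s. x (i, s))"
    "radius k (observations (replay x a) i) z = radius k (\<lambda>s. x (i, s)) z"
proof -
  have "observations (replay x a) i s = x (i, s)" if "s \<in> block k" for s
    using that block_index_bounds(1)[OF assms(1)] k by (intro observations_replay) (auto simp: block_def)
  then show "block_mean k (observations (replay x a) i) = block_mean k (\<lambda>s. x (i, s))"
    "radius k (observations (replay x a) i) z = radius k (\<lambda>s. x (i, s)) z"
    by (intro block_stats_cong; simp)+
qed

lemma policy_replay:
  assumes "2 \<le> n" and "\<forall>i<n. 2 \<le> count_list a i"
  shows "policy n q u (replay x a) =
    (let k = (\<lambda>i. block_index (count_list a i)) in
     decide n (\<lambda>i. block_mean (k i) (\<lambda>s. x (i, s))) (\<lambda>i. radius (k i) (\<lambda>s. x (i, s)) (level q (k i)))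
       (\<lambda>i. radius (k i) (\<lambda>s. x (i, s))
          (strict_level q (k i) (LEAST l. count_list (take l a) i = 2 ^ k i)))
       (\<lambda>i. length a < 2 * count_list a i))"
  using assms unfolding policy_def Let_def
  by (subst if_not_P) (auto simp: pulls_replay hit_replay block_stats_replay not_less intro!: decide_cong)

section \<open>Measurability of the decisions and of the arm sequence\<close>

lemma measurable_decide:
  assumes [measurable]: "\<And>i. m i \<in> borel_measurable M" "\<And>i. r i \<in> borel_measurable M"
    "\<And>i. r' i \<in> borel_measurable M"
  shows "Measurable.pred M (\<lambda>x. decide n (\<lambda>i. m i x) (\<lambda>i. r i x) (\<lambda>i. r' i x) heavy = a)"
proof -
  define h where "h x = leader n (\<lambda>i. m i x + r i x)" for x
  define l where "l x = runner_up n (\<lambda>i. m i x + r i x)" for x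
  have [measurable]: "h \<in> measurable M (count_space UNIV)"
    unfolding h_def leader_def by measurable
  have "l = (\<lambda>x. LEAST i. i < n \<and> i \<noteq> h x \<and> (\<forall>j<n. j \<noteq> h x \<longrightarrow> m j x + r j x \<le> m i x + r i x))"
    by (simp add: l_def runner_up_def h_def fun_eq_iff)
  then have [measurable]: "l \<in> measurable M (count_space UNIV)"
    by (elim ssubst) measurable
  \<comment> \<open>Splitting by the values of leader and runner-up leaves a countable union of
    comparisons between measurable functions.\<close>
  have "decide n (\<lambda>i. m i x) (\<lambda>i. r i x) (\<lambda>i. r' i x) heavy = a \<longleftrightarrow>
    (\<exists>i j. h x = i \<and> l x = j \<and>
      (if m j x + r j x < m i x - r' i x then Stop i = a
       else if r j x < r' i x then (if heavy i then Pull j else Pull i) = a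
       else (if heavy j then Pull i else Pull j) = a))" for x
    by (simp add: decide_def Let_def h_def l_def)
  note * = this
  show ?thesis unfolding * by measurable
qed

context bandit
begin

lemma measurable_coordinate_all [measurable]: "(\<lambda>\<omega>. \<omega> (i, s)) \<in> borel_measurable (tape n D)"
proof (cases "i < n")
  \<comment> \<open>Outside the index set every tape has the constant value
    \<open>undefined\<close>.\<close>
  case False
  then have "\<omega> (i, s) = undefined" if "\<omega> \<in> space (tape n D)" for \<omega>
    using that by (auto simp: tape_def space_PiM PiE_def extensional_def)
  then show ?thesis by (subst measurable_cong[where g = "\<lambda>_. undefined"]) auto
qed (rule measurable_coordinate)

lemma measurable_policy_replay [measurable]:
  assumes "2 \<le> n"
  shows "Measurable.pred (tape n D) (\<lambda>x. policy n q u (replay x a) = b)"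
proof (cases "\<forall>i<n. 2 \<le> count_list a i")
  case True
  have [measurable]: "(\<lambda>x. block_mean k (\<lambda>s. x (i, s))) \<in> borel_measurable (tape n D)" for k i
    unfolding block_mean_def by measurable
  have [measurable]: "(\<lambda>x. radius k (\<lambda>s. x (i, s)) z) \<in> borel_measurable (tape n D)" for k i z
    unfolding radius_def block_dev_def by measurable
  show ?thesis
    unfolding policy_replay[OF assms True] Let_def by (intro measurable_decide) measurable
next
  case False
  \<comment> \<open>In the initial phase the action depends on the counts only, hence is constant in
    the tape.\<close>
  then show ?thesis by (simp add: policy_def pulls_replay not_le)
qed

text \<open>Induction over time: the previous arm sequence has countably many values, and on each of
  them the history is a \<open>replay\<close>.\<close>

lemma measurable_arms_history [measurable]:
  assumes n: "2 \<le> n"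
  shows "Measurable.pred (tape n D) (\<lambda>x. map fst (history (policy n q) u x t) = a)"
proof (induction t arbitrary: a)
  case (Suc t)
  have "map fst (history (policy n q) u x (Suc t)) = a \<longleftrightarrow>
     (\<exists>c. map fst (history (policy n q) u x t) = c \<and>
       ((\<exists>i. policy n q u (replay x c) = Pull i \<and> c @ [i] = a) \<or>
        (\<exists>i. policy n q u (replay x c) = Stop i \<and> c = a)))" for x
  proof -
    define c where "c = map fst (history (policy n q) u x t)"
    have "history (policy n q) u x (Suc t) = step (policy n q) u x (replay x c)"
      using history_replay[of "policy n q" u x t] by (simp add: history_Suc c_def)
    then show ?thesis
      unfolding c_def[symmetric]
      by (cases "policy n q u (replay x c)") (auto simp: step_replay simp del: replay_snoc)
  qed
  note * = this
  note [measurable] = Suc.IH measurable_policy_replay[OF n]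
  show ?case unfolding * by measurable
qed simp

end

section \<open>Sample counts outside the exceptional events\<close>

lemma length_history_le: "length (history A u x t) \<le> t"
  by (induction t) (auto simp: history_Suc step_def split: action.splits)

text \<open>After a stop \<open>step\<close> leaves the history unchanged; hence
  \<open>length (history A u x t) = t\<close> encodes that no stop occurred before time
  \<open>t\<close>, and up to then histories are prefixes of each other.\<close>

lemma running_before:
  assumes "length (history A u x t) = t" "s \<le> t"
  shows "length (history A u x s) = s" "take s (history A u x t) = history A u x s"
proof -
  have "length (history A u x s) = s \<and> take s (history A u x t) = history A u x s"
    using assms
  proof (induction t)
    case (Suc t)
    show ?case
    proof (cases "s = Suc t")
      case False
      with Suc have "s \<le> t" by simp
      have "length (history A u x t) = t"
        using Suc.prems(1) length_history_le[of A u x t]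
        by (auto simp: history_Suc step_def split: action.splits)
      with Suc \<open>s \<le> t\<close> show ?thesis
        by (auto simp: history_Suc[of A u x t] step_def split: action.splits)
    qed (use Suc in simp)
  qed simp
  then show "length (history A u x s) = s" "take s (history A u x t) = history A u x s" by auto
qed

lemma running_Suc_imp_Pull:
  assumes "length (history A u x (Suc t)) = Suc t"
  obtains i where "A u (history A u x t) = Pull i"
    "\<And>j. pulls (history A u x (Suc t)) j = pulls (history A u x t) j + (if i = j then 1 else 0)"
proof -
  have "length (history A u x t) = t" using running_before(1)[OF assms, of t] by simp
  then obtain i where "A u (history A u x t) = Pull i"
    using assms by (auto simp: history_Suc step_def split: action.splits)
  then show thesis using that by (auto simp: history_Suc step_def)
qed

lemma pulls_history_mono:
  assumes "s \<le> t"
  shows "pulls (history A u x s) i \<le> pulls (history A u x t) i"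
  using assms
proof (induction t rule: dec_induct)
  case (step t)
  have "pulls (history A u x t) i \<le> pulls (history A u x (Suc t)) i"
    by (auto simp: history_Suc step_def split: action.splits)
  with step.IH show ?case by linarith
qed simp

lemma sum_pulls_history:
  assumes "valid_policy n A"
  shows "(\<Sum>i<n. pulls (history A u x t) i) = length (history A u x t)"
proof (induction t)
  case (Suc t)
  show ?case
  proof (cases "A u (history A u x t)")
    case (Pull i)
    then have "i < n" using assms by (auto simp: valid_policy_def)
    then show ?thesis using Suc Pull by (simp add: history_Suc step_def sum.distrib)
  qed (use Suc in \<open>simp add: history_Suc step_def\<close>)
qed simp

text \<open>The length condition excludes the times after a stop, at which the history is frozen,
  and the last clause selects the first time; so there is at most one such \<open>t\<close>.\<close>

definition reaches :: "policy \<Rightarrow> real \<Rightarrow> (nat \<times> nat \<Rightarrow> real) \<Rightarrow> nat \<Rightarrow> nat \<Rightarrow> nat \<Rightarrow> bool" where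
  "reaches A u x i N t \<longleftrightarrow> length (history A u x t) = t \<and> pulls (history A u x t) i = N \<and>
     (\<forall>s<t. pulls (history A u x s) i < N)"

lemma hit_reaches:
  assumes run: "length (history A u x t) = t" and "N \<le> pulls (history A u x t) i"
  shows "reaches A u x i N (hit (history A u x t) i N)" "hit (history A u x t) i N \<le> t"
proof -
  let ?P = "\<lambda>l. pulls (take l (history A u x t)) i = N"
  have tk: "pulls (take l (history A u x t)) i = pulls (history A u x l) i" if "l \<le> t" for l
    using running_before(2)[OF run that] by simp
  \<comment> \<open>A discrete intermediate value argument: a count grows by at most one per
    step.\<close>
  have "\<exists>l\<le>t. pulls (history A u x l) i = N"
    using assms
  proof (induction t)
    case (Suc t)
    show ?case
    proof (cases "N \<le> pulls (history A u x t) i")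
      case True
      then obtain l where "l \<le> t" "pulls (history A u x l) i = N"
        using Suc.IH running_before(1)[OF Suc.prems(1), of t] by auto
      then have "l \<le> Suc t" by simp
      with \<open>pulls (history A u x l) i = N\<close> show ?thesis by blast
    next
      case False
      obtain j where "pulls (history A u x (Suc t)) i = pulls (history A u x t) i + (if j = i then 1 else 0)"
        by (rule running_Suc_imp_Pull[OF Suc.prems(1)]) blast
      with False Suc.prems(2) have "pulls (history A u x (Suc t)) i = N"
        by (auto split: if_splits)
      then show ?thesis by blast
    qed
  qed simp
  then obtain l where l: "l \<le> t" "?P l" using tk by auto
  then have P: "?P (hit (history A u x t) i N)" and le: "hit (history A u x t) i N \<le> l"
    unfolding hit_def by (auto intro: LeastI Least_le)
  show le': "hit (history A u x t) i N \<le> t" using le l by simp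
  have "pulls (history A u x s) i < N" if "s < hit (history A u x t) i N" for s
  proof -
    have "pulls (history A u x s) i \<noteq> N"
      using not_less_Least[of s ?P] that tk[of s] le' by (simp add: hit_def)
    moreover have "pulls (history A u x s) i \<le> N"
      using pulls_history_mono[of s "hit (history A u x t) i N" A u x i] that P tk[OF le'] by simp
    ultimately show ?thesis by simp
  qed
  then show "reaches A u x i N (hit (history A u x t) i N)"
    using P tk[OF le'] running_before(1)[OF run le'] by (simp add: reaches_def)
qed

lemma reaches_imp_le: "reaches A u x i N t \<Longrightarrow> N \<le> t"
  using pulls_le_length[of "history A u x t" i] by (simp add: reaches_def)

text \<open>The deterministic half of the argument, for one tape outside the exceptional events.
  \<open>r i\<close> is the excess over \<open>q\<close> at which all blocks of arm \<open>i\<close>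
  are concentrated; the best arm is concentrated at the base level already.\<close>

locale good_tape =
  fixes n b :: nat and q u :: real and x :: "nat \<times> nat \<Rightarrow> real" and \<theta> v d :: "nat \<Rightarrow> real" and r :: "nat \<Rightarrow> nat"
  assumes n: "2 \<le> n" and b: "b < n" and q: "1 \<le> q"
    and v: "\<And>i. i < n \<Longrightarrow> 0 \<le> v i" "\<And>i. i < n \<Longrightarrow> v i \<le> 1"
    and d: "\<And>i. i < n \<Longrightarrow> 0 < d i" "\<And>i. i < n \<Longrightarrow> d i \<le> 1"
    and gap: "\<And>i. i < n \<Longrightarrow> i \<noteq> b \<Longrightarrow> d i = \<theta> b - \<theta> i"
    and gap_b: "\<And>i. i < n \<Longrightarrow> d b \<le> d i"
    and conc_b: "\<And>k. concentrated k (\<lambda>s. x (b, s)) (\<theta> b) (v b) (level q k)"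
    and conc: "\<And>i k. i < n \<Longrightarrow> concentrated k (\<lambda>s. x (i, s)) (\<theta> i) (v i) (level (q + real (r i)) k)"
    and conc_strict: "\<And>i k t. i < n \<Longrightarrow> reaches (policy n q) u x i (2 ^ k) t \<Longrightarrow>
      concentrated k (\<lambda>s. x (i, s)) (\<theta> i) (v i) (strict_level q k t)"
begin

text \<open>\<open>300352 = 4 * 75088\<close>, with the 4 from
  \<open>T < 4 * 2 ^ block_index T\<close>. The summand 6 covers the strict level of a best arm
  holding most samples, which exceeds its level by at most \<open>2 * ln 8\<close>.\<close>

definition budget :: "nat \<Rightarrow> real" where
  "budget i = 300352 * (v i / (d i)\<^sup>2 + 1 / d i) * (q + 6 + real (r i) + LL (1 / d i))"

lemma budget_ge: "i < n \<Longrightarrow> 2 \<le> budget i"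
proof -
  assume i: "i < n"
  have "1 \<le> 1 / d i" using d[OF i] by simp
  then have "1 \<le> v i / (d i)\<^sup>2 + 1 / d i" using v[OF i] by (smt (verit) divide_nonneg_nonneg zero_le_power2)
  moreover have "1 \<le> q + 6 + real (r i) + LL (1 / d i)" using q LL_ge_one[OF d[OF i]] by simp
  ultimately have "1 * 1 \<le> (v i / (d i)\<^sup>2 + 1 / d i) * (q + 6 + real (r i) + LL (1 / d i))"
    by (intro mult_mono) auto
  then show ?thesis unfolding budget_def mult.assoc by linarith
qed

abbreviation "A \<equiv> policy n q"
abbreviation "H \<equiv> history A u x"
abbreviation "total_budget \<equiv> \<Sum>i<n. budget i"

lemma level_nonneg: "0 \<le> level q k"
  using q by (simp add: level_def)

lemma count_le_budget:
  assumes i: "i < n" and T: "2 \<le> T" and k: "k = block_index T"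
    and wide: "d i \<le> 2 * width k (v i) (q + 6 + real (r i) + 2 * ln (real k + 2))"
  shows "real T \<le> budget i"
proof -
  have "2 ^ k \<le> 75088 * (v i / (d i)\<^sup>2 + 1 / d i) * (q + 6 + real (r i) + LL (1 / d i))"
  proof (rule block_length_le)
    show "2 ^ k \<le> 5776 * (v i / (d i)\<^sup>2 + 1 / d i) * (q + 6 + real (r i) + 2 * ln (real k + 2))"
      by (rule width_ge_imp_le[OF d(1)[OF i] wide v(1)[OF i]]) (use q in simp)
  qed (use d v i q in auto)
  moreover have "real T \<le> real (4 * 2 ^ k)"
    using block_index_bounds(2)[OF T] k by (subst of_nat_le_iff) simp
  moreover have "budget i = 4 * (75088 * (v i / (d i)\<^sup>2 + 1 / d i) * (q + 6 + real (r i) + LL (1 / d i)))"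
    unfolding budget_def by algebra
  ultimately show ?thesis by simp
qed

context
  fixes t :: nat
  assumes run: "length (H t) = t" and two: "\<forall>i<n. 2 \<le> pulls (H t) i"
begin

definition "T i = pulls (H t) i"
definition "k i = block_index (T i)"
definition "m i = block_mean (k i) (\<lambda>s. x (i, s))"
definition "\<rho> i = radius (k i) (\<lambda>s. x (i, s)) (level q (k i))"
definition "\<rho>' i = radius (k i) (\<lambda>s. x (i, s)) (strict_level q (k i) (hit (H t) i (2 ^ k i)))"

lemma policy_eq_decide: "A u (H t) = decide n m \<rho> \<rho>' (\<lambda>i. t < 2 * T i)"
proof -
  define a where "a = map fst (H t)"
  have h: "H t = replay x a" using history_replay[of A u x t] by (simp add: a_def)
  have T: "T i = count_list a i" for i by (simp add: T_def h pulls_replay)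
  have "length a = t" using run by (simp add: a_def)
  have "A u (H t) = A u (replay x a)" by (simp add: h)
  also have "\<dots> = decide n m \<rho> \<rho>' (\<lambda>i. t < 2 * T i)"
    by (subst policy_replay)
      (use n two \<open>length a = t\<close> in \<open>auto simp: Let_def m_def[abs_def] \<rho>_def[abs_def] \<rho>'_def[abs_def] k_def T h pulls_replay hit_replay\<close>)
  finally show ?thesis .
qed

lemma reaches_block:
  assumes "i < n"
  shows "reaches A u x i (2 ^ k i) (hit (H t) i (2 ^ k i))"
    "2 ^ k i \<le> hit (H t) i (2 ^ k i)" "hit (H t) i (2 ^ k i) \<le> t"
proof -
  have "2 ^ k i \<le> pulls (H t) i"
    using block_index_bounds(1)[of "T i"] two assms by (simp add: k_def T_def)
  from hit_reaches[OF run this] show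
    "reaches A u x i (2 ^ k i) (hit (H t) i (2 ^ k i))" "hit (H t) i (2 ^ k i) \<le> t" by auto
  then show "2 ^ k i \<le> hit (H t) i (2 ^ k i)" using reaches_imp_le by blast
qed

lemma strict_level_ge:
  assumes "i < n"
  shows "level q (k i) \<le> strict_level q (k i) (hit (H t) i (2 ^ k i))"
proof -
  have "(2::real) ^ k i \<le> real (hit (H t) i (2 ^ k i))"
    using of_nat_mono[OF reaches_block(2)[OF assms], where ?'a = real] by simp
  then have "1 \<le> real (hit (H t) i (2 ^ k i)) / 2 ^ k i" by simp
  then show ?thesis by (simp add: strict_level_def)
qed

lemma radius_le_strict: "i < n \<Longrightarrow> \<rho> i \<le> \<rho>' i"
  unfolding \<rho>_def \<rho>'_def by (intro radius_mono strict_level_ge level_nonneg)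

lemma upper_bound_best: "\<theta> b \<le> m b + \<rho> b"
  using concentrated_imp_le_radius[OF conc_b v(1)[OF b] level_nonneg, of "k b"]
  unfolding m_def \<rho>_def by linarith

lemma lower_bound_valid: "i < n \<Longrightarrow> m i - \<rho>' i \<le> \<theta> i"
  using concentrated_imp_le_radius[OF conc_strict[OF _ reaches_block(1)] v(1), of i]
    strict_level_ge[of i] level_nonneg[of "k i"]
  unfolding m_def \<rho>'_def by force

lemma count_le_budget_if_close:
  assumes i: "i < n" "i \<noteq> b" and close: "d i / 2 \<le> m i - \<theta> i + 3 * \<rho> i"
  shows "real (T i) \<le> budget i"
proof (rule count_le_budget[OF i(1) _ refl])
  show "2 \<le> T i" using two i by (simp add: T_def)
  have "\<bar>m i - \<theta> i\<bar> + 3 * \<rho> i \<le> width (k i) (v i) (q + 6 + real (r i) + 2 * ln (real (k i) + 2))"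
    unfolding m_def \<rho>_def
    by (rule concentrated_width[OF conc[OF i(1)] v(1)[OF i(1)]]) (use q in \<open>auto simp: level_def\<close>)
  then show "d i \<le> 2 * width (block_index (T i)) (v i) (q + 6 + real (r i) + 2 * ln (real (block_index (T i)) + 2))"
    using close abs_ge_self[of "m i - \<theta> i"] by (simp add: k_def[symmetric])
qed

lemma count_le_budget_if_upper_ge:
  assumes i: "i < n" "i \<noteq> b" and ge: "\<theta> b \<le> m i + \<rho> i"
  shows "real (T i) \<le> budget i"
proof (rule count_le_budget_if_close[OF i])
  have "0 \<le> \<rho> i" by (simp add: \<rho>_def radius_nonneg level_nonneg)
  then show "d i / 2 \<le> m i - \<theta> i + 3 * \<rho> i"
    using gap[OF i] d(1)[OF i(1)] ge by linarith
qed

text \<open>An arm holding more than half of the samples entered its last block recently in relative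
  terms, so its strict level is within a constant of the ordinary one. Either its block is still too
  short, or its strict lower bound is accurate to half the gap.\<close>

lemma best_count_or_lower_bound:
  assumes heavy: "t < 2 * T b"
  shows "real t < 2 * budget b \<or> \<theta> b - d b / 2 \<le> m b - \<rho>' b"
proof (cases "d b \<le> 2 * width (k b) (v b) (q + 6 + real (r b) + 2 * ln (real (k b) + 2))")
  case True
  have "real (T b) \<le> budget b"
    by (rule count_le_budget[OF b _ refl]) (use two b True in \<open>auto simp: k_def T_def\<close>)
  then show ?thesis using heavy by linarith
next
  case False
  let ?w = "hit (H t) b (2 ^ k b)" and ?X = "q + 6 + real (r b) + 2 * ln (real (k b) + 2)"
  \<comment> \<open>The entry time is at most \<open>t < 2 * T b\<close>, and
    \<open>T b < 4 * 2 ^ k b\<close>.\<close>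
  have "?w < 8 * 2 ^ k b"
    using reaches_block(3)[OF b] heavy block_index_bounds(2)[of "T b"] two b by (auto simp: k_def T_def)
  then have "real ?w < real (8 * 2 ^ k b)" by (subst of_nat_less_iff)
  then have "real ?w < 8 * 2 ^ k b" by simp
  moreover have "0 < ?w" using reaches_block(2)[OF b] by (metis less_le_trans zero_less_numeral zero_less_power)
  ultimately have "ln (real ?w / 2 ^ k b) \<le> 3"
    by (intro ln_le_numeral[of _ 3, simplified]) (auto simp: divide_le_eq)
  then have le: "strict_level q (k b) ?w \<le> ?X"
    by (simp add: strict_level_def level_def)
  have "\<bar>m b - \<theta> b\<bar> + 3 * \<rho>' b \<le> width (k b) (v b) ?X"
    unfolding m_def \<rho>'_def
    by (rule concentrated_width[OF conc_b v(1)[OF b] _ le])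
      (use strict_level_ge[OF b] level_nonneg[of "k b"] in \<open>auto simp: level_def\<close>)
  moreover have "0 \<le> \<rho>' b" using radius_le_strict[OF b] by (simp add: \<rho>_def) (meson level_nonneg order_trans radius_nonneg)
  ultimately show ?thesis using False abs_ge_minus_self[of "m b - \<theta> b"] by linarith
qed

text \<open>For a wrong answer \<open>j\<close>, the runner-up's upper bound dominates that of
  \<open>b\<close>, so a valid lower bound of \<open>j\<close> would lie above \<theta> of the best
  arm.\<close>

lemma stop_imp_best:
  assumes "A u (H t) = Stop j"
  shows "j = b"
proof (rule ccontr)
  assume "j \<noteq> b"
  let ?U = "\<lambda>i. m i + \<rho> i"
  have j: "j = leader n ?U" and less: "?U (runner_up n ?U) < m j - \<rho>' j"
    using assms unfolding policy_eq_decide decide_def Let_def by (auto split: if_splits)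
  have "j < n" using j leader_props(1)[of n ?U] n by simp
  have "?U b \<le> ?U (runner_up n ?U)"
    using runner_up_props(3)[OF n b, of ?U] \<open>j \<noteq> b\<close> j by simp
  then have "\<theta> b < \<theta> j"
    using less lower_bound_valid[OF \<open>j < n\<close>] upper_bound_best by linarith
  then show False using gap[OF \<open>j < n\<close> \<open>j \<noteq> b\<close>] d(1)[OF \<open>j < n\<close>] by simp
qed

lemma pull_bounds:
  assumes "A u (H t) = Pull j"
  shows "j \<noteq> b \<Longrightarrow> real (T j) \<le> budget j \<or> real t < 2 * budget b"
    and "j = b \<Longrightarrow> 2 * T b \<le> t"
proof -
  let ?U = "\<lambda>i. m i + \<rho> i"
  define h where "h = leader n ?U"
  define l where "l = runner_up n ?U"
  have h: "h < n" "\<And>i. i < n \<Longrightarrow> ?U i \<le> ?U h"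
    using leader_props[where U = ?U, of n] n by (auto simp: h_def)
  have l: "l < n" "l \<noteq> h" "\<And>i. i < n \<Longrightarrow> i \<noteq> h \<Longrightarrow> ?U i \<le> ?U l"
    using runner_up_props[OF n, where U = ?U] by (auto simp: h_def l_def)
  have run': "m h - \<rho>' h \<le> ?U l"
    and cases: "\<rho> l < \<rho>' h \<and> t < 2 * T h \<and> j = l \<or> \<rho> l < \<rho>' h \<and> 2 * T h \<le> t \<and> j = h \<or>
      \<rho>' h \<le> \<rho> l \<and> t < 2 * T l \<and> j = h \<or> \<rho>' h \<le> \<rho> l \<and> 2 * T l \<le> t \<and> j = l"
    using assms unfolding policy_eq_decide decide_def Let_def h_def l_def by (auto split: if_splits)
  \<comment> \<open>Two arms cannot both hold more than half of the samples, so the arm pulled after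
    a swap is not heavy.\<close>
  have "T h + T l \<le> t"
  proof -
    have "(\<Sum>i\<in>{h, l}. T i) \<le> (\<Sum>i<n. T i)"
      by (rule sum_mono2) (use h l in auto)
    then show ?thesis
      using sum_pulls_history[OF valid_policy_policy[OF n, of q], of u x t] run l(2) by (simp add: T_def)
  qed
  then show "j = b \<Longrightarrow> 2 * T b \<le> t" using cases by auto
  assume "j \<noteq> b"
  show "real (T j) \<le> budget j \<or> real t < 2 * budget b"
  proof (cases "h = b")
    case False
    \<comment> \<open>If the best arm is not the leader, both candidates have upper bounds at least
      as large as its own.\<close>
    then have "\<theta> b \<le> ?U h" "\<theta> b \<le> ?U l"
      using h(2)[OF b] l(3)[OF b] upper_bound_best by linarith+
    then show ?thesis
      using count_le_budget_if_upper_ge[of j] \<open>j \<noteq> b\<close> cases h(1) l(1) by auto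
  next
    case True
    then have j: "j = l" "j < n" using cases \<open>j \<noteq> b\<close> l by auto
    note close = count_le_budget_if_close[OF \<open>j < n\<close> \<open>j \<noteq> b\<close>]
    have ge0: "0 \<le> \<rho> j" by (simp add: \<rho>_def radius_nonneg level_nonneg)
    consider "\<rho>' b \<le> \<rho> j" | "t < 2 * T b" using cases True j l(2) by auto
    then show ?thesis
    proof cases
      case 1
      \<comment> \<open>The radius comparison allows \<open>\<rho>' b\<close> to be replaced by
        \<open>\<rho> j\<close>, so the gap is at most the deviation of \<open>j\<close> plus three
        of its own radii.\<close>
      have "\<theta> b - 2 * \<rho>' b \<le> m b - \<rho>' b" using upper_bound_best radius_le_strict[OF b] by linarith
      then have "\<theta> b - 2 * \<rho> j \<le> m j + \<rho> j" using run' 1 True j by simp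
      then have "d j / 2 \<le> m j - \<theta> j + 3 * \<rho> j"
        using gap[OF \<open>j < n\<close> \<open>j \<noteq> b\<close>] d(1)[OF \<open>j < n\<close>] ge0 by linarith
      then show ?thesis using close by simp
    next
      case 2
      from best_count_or_lower_bound[OF 2] show ?thesis
      proof
        assume "\<theta> b - d b / 2 \<le> m b - \<rho>' b"
        then have "\<theta> b - d j / 2 \<le> m j + \<rho> j" using run' True j gap_b[OF \<open>j < n\<close>] by simp
        then have "d j / 2 \<le> m j - \<theta> j + 3 * \<rho> j"
          using gap[OF \<open>j < n\<close> \<open>j \<noteq> b\<close>] d(1)[OF \<open>j < n\<close>] ge0 by linarith
        then show ?thesis using close by simp
      qed simp
    qed
  qed
qed

end

lemma pull_cases:
  assumes run: "length (H t) = t" and pull: "A u (H t) = Pull j"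
  shows "j < n" and "j \<noteq> b \<Longrightarrow> real (pulls (H t) j) \<le> budget j \<or> real t < 2 * budget b"
    and "j = b \<Longrightarrow> 2 * pulls (H t) b \<le> t + 2"
proof -
  show "j < n" using pull valid_policy_policy[OF n, of q] by (auto simp: valid_policy_def)
  have "(j \<noteq> b \<longrightarrow> real (pulls (H t) j) \<le> budget j \<or> real t < 2 * budget b) \<and>
    (j = b \<longrightarrow> 2 * pulls (H t) b \<le> t + 2)"
  proof (cases "\<forall>i<n. 2 \<le> pulls (H t) i")
    case True
    from pull_bounds[OF run True pull] show ?thesis by (auto simp: T_def[OF run True])
  next
    case False
    then have ex: "\<exists>i<n. pulls (H t) i < 2" by auto
    then have "j = (LEAST i. i < n \<and> pulls (H t) i < 2)"
      using pull by (simp add: policy_def)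
    \<comment> \<open>The initial pulls are covered by the lower bound 2 on every budget and by the
      additive 2 in the bound for the best arm.\<close>
    with LeastI_ex[OF ex] have "pulls (H t) j < 2" by simp
    then show ?thesis using budget_ge[OF \<open>j < n\<close>] by auto
  qed
  then show "j \<noteq> b \<Longrightarrow> real (pulls (H t) j) \<le> budget j \<or> real t < 2 * budget b"
    "j = b \<Longrightarrow> 2 * pulls (H t) b \<le> t + 2" by auto
qed

lemma best_pulls_le:
  assumes "length (H t) = t"
  shows "2 * pulls (H t) b \<le> t + 4"
  using assms
proof (induction t)
  case (Suc t)
  have run: "length (H t) = t" using running_before(1)[OF Suc.prems, of t] by simp
  obtain i where i: "A u (H t) = Pull i" "pulls (H (Suc t)) b = pulls (H t) b + (if i = b then 1 else 0)"
    by (rule running_Suc_imp_Pull[OF Suc.prems]) blast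
  show ?case using pull_cases(3)[OF run i(1)] Suc.IH[OF run] i(2) by (cases "i = b") auto
qed simp

text \<open>The sum can grow only when an arm above its budget is pulled, which happens only while
  \<open>t < 2 * budget b\<close>; at such a time the number of all samples bounds it trivially. A
  pull at a count within budget leads to at most \<open>budget j + 1\<close>, which explains the
  offset.\<close>

lemma excess_pulls_le:
  assumes "length (H t) = t"
  shows "(\<Sum>j\<in>{..<n} - {b}. max 0 (real (pulls (H t) j) - (budget j + 1))) \<le> 2 * budget b + 1"
  using assms
proof (induction t)
  case 0
  have "(\<Sum>j\<in>{..<n} - {b}. max 0 (real (pulls (H 0) j) - (budget j + 1))) = 0"
    by (rule sum.neutral) (use budget_ge in force)
  then show ?case using budget_ge[OF b] by linarith
next
  case (Suc t)
  have run: "length (H t) = t" using running_before(1)[OF Suc.prems, of t] by simp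
  obtain i where i: "A u (H t) = Pull i"
    and step: "\<And>j. pulls (H (Suc t)) j = pulls (H t) j + (if i = j then 1 else 0)"
    using running_Suc_imp_Pull[OF Suc.prems] by blast
  show ?case
  proof (cases "i = b \<or> real (pulls (H t) i) \<le> budget i")
    case True
    then have "(\<Sum>j\<in>{..<n} - {b}. max 0 (real (pulls (H (Suc t)) j) - (budget j + 1)))
        \<le> (\<Sum>j\<in>{..<n} - {b}. max 0 (real (pulls (H t) j) - (budget j + 1)))"
      by (intro sum_mono) (auto simp: step)
    then show ?thesis using Suc.IH[OF run] by linarith
  next
    case False
    then have "real t < 2 * budget b" using pull_cases(2)[OF run i] by auto
    have "(\<Sum>j\<in>{..<n} - {b}. max 0 (real (pulls (H (Suc t)) j) - (budget j + 1)))
      \<le> (\<Sum>j\<in>{..<n} - {b}. real (pulls (H (Suc t)) j))"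
      by (intro sum_mono) (use budget_ge in \<open>auto simp: max_def\<close>, force)
    also have "\<dots> \<le> (\<Sum>j<n. real (pulls (H (Suc t)) j))"
      by (intro sum_mono2) auto
    also have "\<dots> = real (Suc t)"
      using sum_pulls_history[OF valid_policy_policy[OF n, of q], of u x "Suc t"] Suc.prems
      by (simp flip: of_nat_sum)
    finally show ?thesis using \<open>real t < 2 * budget b\<close> by simp
  qed
qed

text \<open>The best arm holds at most about half of the samples, so \<open>t\<close> is at most
  about twice the number of pulls of the others, which is their budgets plus the excess. Budgets of
  at least 2 absorb the additive constants.\<close>

lemma running_imp_le:
  assumes run: "length (H t) = t"
  shows "real t \<le> 10 * total_budget"
proof -
  let ?O = "\<Sum>j\<in>{..<n} - {b}. real (pulls (H t) j)"
  have "real t = (\<Sum>j<n. real (pulls (H t) j))"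
    using sum_pulls_history[OF valid_policy_policy[OF n, of q], of u x t] run by (simp flip: of_nat_sum)
  also have "\<dots> = real (pulls (H t) b) + ?O"
    using b by (subst sum.remove[of _ b]) auto
  finally have t: "real t = real (pulls (H t) b) + ?O" .
  have "?O \<le> (\<Sum>j\<in>{..<n} - {b}. (budget j + 1) + max 0 (real (pulls (H t) j) - (budget j + 1)))"
    by (intro sum_mono) auto
  also have "\<dots> \<le> (\<Sum>j\<in>{..<n} - {b}. budget j + 1) + (2 * budget b + 1)"
    unfolding sum.distrib[of "\<lambda>j. budget j + 1"]
    by (intro add_left_mono excess_pulls_le run)
  also have "(\<Sum>j\<in>{..<n} - {b}. budget j + 1) \<le> (\<Sum>j\<in>{..<n} - {b}. 3 / 2 * budget j)"
  proof (rule sum_mono)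
    show "budget j + 1 \<le> 3 / 2 * budget j" if "j \<in> {..<n} - {b}" for j
      using budget_ge[of j] that by auto
  qed
  also have "\<dots> = 3 / 2 * (total_budget - budget b)"
    unfolding sum_distrib_left[symmetric] using b by (simp add: sum_diff1)
  finally have "?O \<le> 3 / 2 * total_budget + budget b / 2 + 1" by (simp add: field_simps)
  moreover have "2 * real (pulls (H t) b) \<le> real t + 4"
    using best_pulls_le[OF run] by linarith
  moreover have "budget b \<le> total_budget"
    by (rule member_le_sum) (use b budget_ge in \<open>auto intro: order_trans[of 0 2]\<close>)
  ultimately show ?thesis using t budget_ge[OF b] by linarith
qed

theorem stops_with_best:
  "\<exists>t. A u (H t) = Stop b \<and> real (length (H t)) \<le> 10 * total_budget"
proof -
  \<comment> \<open>A time beyond the bound for running histories, so the policy has stopped by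
    then; the least non-running time \<open>t\<close> has the stopping decision at its
    predecessor.\<close>
  define T0 where "T0 = nat (\<lfloor>10 * total_budget\<rfloor> + 1)"
  have "\<not> length (H T0) = T0"
    using running_imp_le[of T0] by (auto simp: T0_def) linarith
  then have ex: "\<exists>t. length (H t) \<noteq> t" by blast
  define t where "t = (LEAST t. length (H t) \<noteq> t)"
  have t: "length (H t) \<noteq> t" "\<And>s. s < t \<Longrightarrow> length (H s) = s"
    using LeastI_ex[OF ex] not_less_Least[of _ "\<lambda>t. length (H t) \<noteq> t"] by (auto simp: t_def)
  then obtain s where s: "t = Suc s" by (cases t) auto
  have run: "length (H s) = s" using t(2)[of s] s by simp
  have stop: "\<exists>j. A u (H s) = Stop j"
    using t(1) run by (auto simp: s history_Suc step_def split: action.splits)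
  then obtain j where j: "A u (H s) = Stop j" by blast
  have "\<not> (\<exists>i<n. pulls (H s) i < 2)" using j by (simp add: policy_def split: if_splits)
  then have "\<forall>i<n. 2 \<le> pulls (H s) i" by (meson not_less)
  then have "j = b" using stop_imp_best[OF run _ j] by blast
  then show ?thesis using j running_imp_le[OF run] run by auto
qed

end

section \<open>Probability of the exceptional events\<close>

text \<open>Up to this time the run has read fewer than \<open>N\<close> observations of arm
  \<open>i\<close>. This makes the passage time independent of the block starting at
  \<open>N\<close>.\<close>

lemma reaches_local:
  assumes agree: "\<And>j s. j \<noteq> i \<or> s < N \<Longrightarrow> x (j, s) = x' (j, s)"
    and reach: "reaches A u x i N t"
  shows "reaches A u x' i N t"
proof -
  have "history A u x' s = history A u x s" if "s \<le> t" for s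
    using that
  proof (induction s)
    case (Suc s)
    then have "pulls (history A u x s) i < N" using reach by (simp add: reaches_def)
    then have "step A u x' (history A u x s) = step A u x (history A u x s)"
      using agree by (auto simp: step_def split: action.splits)
    then show ?case using Suc by (simp add: history_Suc)
  qed simp
  then show ?thesis using reach by (simp add: reaches_def)
qed

lemma reaches_unique: "reaches A u x i N t \<Longrightarrow> reaches A u x i N t' \<Longrightarrow> t = t'"
  unfolding reaches_def by (metis less_irrefl nat_neq_iff)

text \<open>Only one arm is sampled per step; distinct passage times are needed for ranking the
  arms.\<close>

lemma reaches_inj:
  assumes i: "reaches A u x i N t" and j: "reaches A u x j N t" and "0 < N"
  shows "i = j"
proof (cases t)
  case 0
  then show ?thesis using i \<open>0 < N\<close> by (simp add: reaches_def)
next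
  case (Suc s)
  have run: "length (history A u x (Suc s)) = Suc s" using i Suc by (simp add: reaches_def)
  obtain a where a: "\<And>j. pulls (history A u x (Suc s)) j = pulls (history A u x s) j + (if a = j then 1 else 0)"
    by (rule running_Suc_imp_Pull[OF run]) blast
  have "a = l" if "reaches A u x l N t" for l
  proof (rule ccontr)
    assume "a \<noteq> l"
    then have "pulls (history A u x t) l = pulls (history A u x s) l" using a[of l] Suc by simp
    moreover have "s < t" using Suc by simp
    ultimately show False using that unfolding reaches_def by (metis less_irrefl)
  qed
  then show ?thesis using i j by blast
qed

section \<open>Summability over blocks and over the ranks of passage times\<close>

lemma inverse_square_le: "1 / (real k + 2)\<^sup>2 \<le> 1 / (real k + 1) - 1 / (real k + 2)"
proof -
  have "1 / (real k + 2)\<^sup>2 \<le> 1 / ((real k + 1) * (real k + 2))"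
    unfolding power2_eq_square by (intro divide_left_mono mult_right_mono) auto
  also have "\<dots> = 1 / (real k + 1) - 1 / (real k + 2)"
    by (simp add: diff_frac_eq)
  finally show ?thesis .
qed

lemma sum_inverse_squares_shift_le: "(\<Sum>k<K. 1 / (real k + 2)\<^sup>2) \<le> 1"
proof -
  have "(\<Sum>k<K. 1 / (real k + 2)\<^sup>2) \<le> 1 - 1 / (real K + 1)"
  proof (induction K)
    case (Suc K)
    then show ?case using inverse_square_le[of K] by (simp add: add.commute)
  qed simp
  then show ?thesis by (smt (verit) divide_nonneg_nonneg of_nat_0_le_iff)
qed

lemma sum_inverse_squares_le: "(\<Sum>m=1..M. 1 / (real m)\<^sup>2) \<le> 2"
proof (cases M)
  case (Suc K)
  have "(\<Sum>m=1..M. 1 / (real m)\<^sup>2) = 1 + (\<Sum>k<K. 1 / (real (Suc (Suc k)))\<^sup>2)"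
    unfolding Suc One_nat_def sum.atLeast1_atMost_eq sum.lessThan_Suc_shift by simp
  then show ?thesis using sum_inverse_squares_shift_le[of K] by (simp add: add.commute)
qed simp

text \<open>The arm of rank \<open>m\<close> in the order of passage times has time at least
  \<open>m * N\<close>, so the terms are dominated by \<open>1 / m\<^sup>2\<close>.\<close>

lemma sum_squares_by_rank:
  fixes \<tau> :: "'a \<Rightarrow> nat"
  assumes "finite R" "inj_on \<tau> R" "0 < N"
    and rank: "\<And>i. i \<in> R \<Longrightarrow> N * card {j\<in>R. \<tau> j \<le> \<tau> i} \<le> \<tau> i"
  shows "(\<Sum>i\<in>R. (real N / real (\<tau> i))\<^sup>2) \<le> 2"
proof -
  define \<rho> where "\<rho> i = card {j\<in>R. \<tau> j \<le> \<tau> i}" for i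
  have less: "\<rho> i < \<rho> j" if "i \<in> R" "j \<in> R" "\<tau> i < \<tau> j" for i j
  proof -
    have "{l\<in>R. \<tau> l \<le> \<tau> i} \<subseteq> {l\<in>R. \<tau> l \<le> \<tau> j}" "j \<in> {l\<in>R. \<tau> l \<le> \<tau> j}" "j \<notin> {l\<in>R. \<tau> l \<le> \<tau> i}"
      using that by auto
    then show ?thesis
      unfolding \<rho>_def using assms(1) by (intro psubset_card_mono) auto
  qed
  have inj: "inj_on \<rho> R"
  proof (rule inj_onI)
    fix i j assume ij: "i \<in> R" "j \<in> R" "\<rho> i = \<rho> j"
    then have "\<tau> i = \<tau> j" using less[of i j] less[of j i] by (metis less_irrefl nat_neq_iff)
    then show "i = j" using assms(2) ij by (simp add: inj_on_def)
  qed
  have pos: "0 < \<rho> i" if "i \<in> R" for i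
    using that assms(1) by (auto simp: \<rho>_def card_gt_0_iff)
  have le: "\<rho> i \<le> card R" for i
    unfolding \<rho>_def using assms(1) by (intro card_mono) auto
  have "(\<Sum>i\<in>R. (real N / real (\<tau> i))\<^sup>2) \<le> (\<Sum>i\<in>R. 1 / (real (\<rho> i))\<^sup>2)"
  proof (rule sum_mono)
    fix i assume i: "i \<in> R"
    have "real (N * \<rho> i) \<le> real (\<tau> i)" using rank[OF i] by (simp only: of_nat_le_iff \<rho>_def)
    moreover have "0 < real N * real (\<rho> i)" using pos[OF i] assms(3) by simp
    ultimately have "real N / real (\<tau> i) \<le> real N / (real N * real (\<rho> i))"
      by (intro divide_left_mono) auto
    also have "\<dots> = 1 / real (\<rho> i)" using assms(3) by simp
    finally have "(real N / real (\<tau> i))\<^sup>2 \<le> (1 / real (\<rho> i))\<^sup>2" by (intro power_mono) auto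
    then show "(real N / real (\<tau> i))\<^sup>2 \<le> 1 / (real (\<rho> i))\<^sup>2" by (simp add: power_divide)
  qed
  also have "\<dots> = (\<Sum>m\<in>\<rho> ` R. 1 / (real m)\<^sup>2)" by (simp add: sum.reindex[OF inj])
  also have "\<dots> \<le> (\<Sum>m=1..card R. 1 / (real m)\<^sup>2)"
    by (rule sum_mono2) (use pos le in \<open>auto simp: Suc_le_eq\<close>)
  also have "\<dots> \<le> 2" by (rule sum_inverse_squares_le)
  finally show ?thesis .
qed

text \<open>The rank condition holds because each arm that reached \<open>N\<close> by time
  \<open>\<tau> i\<close> accounts for \<open>N\<close> samples of its own.\<close>

lemma sum_reaches_le:
  assumes valid: "valid_policy n A" and N: "0 < N"
    and R: "R = {i. i < n \<and> (\<exists>t. reaches A u x i N t)}" and \<tau>: "\<And>i. i \<in> R \<Longrightarrow> reaches A u x i N (\<tau> i)"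
  shows "(\<Sum>i\<in>R. (real N / real (\<tau> i))\<^sup>2) \<le> 2"
proof (rule sum_squares_by_rank[OF _ _ N])
  show "finite R" by (simp add: R)
  show "inj_on \<tau> R" by (rule inj_onI) (metis \<tau> reaches_inj N)
  fix i assume i: "i \<in> R"
  let ?J = "{j\<in>R. \<tau> j \<le> \<tau> i}"
  have "N * card ?J = (\<Sum>j\<in>?J. N)" by simp
  also have "\<dots> \<le> (\<Sum>j\<in>?J. pulls (history A u x (\<tau> i)) j)"
  proof (rule sum_mono)
    fix j assume "j \<in> ?J"
    then show "N \<le> pulls (history A u x (\<tau> i)) j"
      using \<tau>[of j] pulls_history_mono[of "\<tau> j" "\<tau> i" A u x j] by (simp add: reaches_def)
  qed
  also have "\<dots> \<le> (\<Sum>j<n. pulls (history A u x (\<tau> i)) j)"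
    by (rule sum_mono2) (auto simp: R)
  also have "\<dots> = \<tau> i"
    using sum_pulls_history[OF valid, of u x "\<tau> i"] \<tau>[OF i] by (simp add: reaches_def)
  finally show "N * card ?J \<le> \<tau> i" .
qed

lemma suminf_indicator_unique:
  fixes f :: "nat \<Rightarrow> ennreal"
  assumes "P s" "\<And>t. P t \<Longrightarrow> t = s"
  shows "(\<Sum>t. if P t then f t else 0) = f s"
proof -
  have "(\<Sum>t. if P t then f t else 0) = (\<Sum>t\<in>{s}. if P t then f t else 0)"
    by (rule suminf_finite) (auto dest: assms(2))
  then show ?thesis using assms(1) by simp
qed

lemma suminf_reaches_le:
  assumes valid: "valid_policy n A" and N: "0 < N"
  shows "(\<Sum>i<n. \<Sum>t. if reaches A u x i N t then ennreal ((real N / real t)\<^sup>2) else 0) \<le> 2"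
proof -
  define R where "R = {i. i < n \<and> (\<exists>t. reaches A u x i N t)}"
  define \<tau> where "\<tau> i = (SOME t. reaches A u x i N t)" for i
  have \<tau>: "reaches A u x i N (\<tau> i)" if "i \<in> R" for i
    using that someI_ex[of "reaches A u x i N"] by (simp add: R_def \<tau>_def)
  have "(\<Sum>i<n. \<Sum>t. if reaches A u x i N t then ennreal ((real N / real t)\<^sup>2) else 0)
    = (\<Sum>i\<in>R. \<Sum>t. if reaches A u x i N t then ennreal ((real N / real t)\<^sup>2) else 0)"
    by (rule sum.mono_neutral_right) (auto simp: R_def)
  also have "\<dots> = (\<Sum>i\<in>R. ennreal ((real N / real (\<tau> i))\<^sup>2))"
  proof (rule sum.cong[OF refl])
    fix i assume "i \<in> R"
    show "(\<Sum>t. if reaches A u x i N t then ennreal ((real N / real t)\<^sup>2) else 0) = ennreal ((real N / real (\<tau> i))\<^sup>2)"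
      by (rule suminf_indicator_unique[where P = "reaches A u x i N"])
        (rule \<tau>[OF \<open>i \<in> R\<close>], erule reaches_unique, rule \<tau>[OF \<open>i \<in> R\<close>])
  qed
  also have "\<dots> = ennreal (\<Sum>i\<in>R. (real N / real (\<tau> i))\<^sup>2)" by simp
  also have "\<dots> \<le> ennreal 2"
    by (intro ennreal_leI sum_reaches_le[OF valid N R_def \<tau>])
  finally show ?thesis by simp
qed

lemma exp_minus_double_ln: "0 < a \<Longrightarrow> exp (- (2 * ln a)) = 1 / (a::real)\<^sup>2"
  by (simp add: exp_minus exp_double inverse_eq_divide)

lemma exp_minus_level: "exp (- level q k) = exp (- q) / (real k + 2)\<^sup>2"
proof -
  have "exp (- level q k) = exp (- q) * exp (- (2 * ln (real k + 2)))"
    by (simp only: level_def minus_add_distrib exp_add)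
  then show ?thesis by (subst (asm) exp_minus_double_ln) simp_all
qed

lemma exp_minus_strict_level:
  assumes "0 < t"
  shows "exp (- strict_level q k t) = exp (- q) / (real k + 2)\<^sup>2 * (2 ^ k / real t)\<^sup>2"
proof -
  have "exp (- strict_level q k t) = exp (- level q k) * exp (- (2 * ln (real t / 2 ^ k)))"
    by (simp only: strict_level_def minus_add_distrib exp_add)
  also have "exp (- (2 * ln (real t / 2 ^ k))) = (2 ^ k / real t)\<^sup>2"
    using assms by (subst exp_minus_double_ln) (simp_all add: power_divide)
  finally show ?thesis by (simp add: exp_minus_level)
qed

lemma suminf_inverse_squares_le: 
  assumes that: "0 \<le> c"
  shows "(\<Sum>k. ennreal (c / (real k + 2)\<^sup>2)) \<le> ennreal c"
proof -
  have "(\<Sum>k<K. ennreal (c / (real k + 2)\<^sup>2)) \<le> ennreal c" for K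
  proof -
    have "(\<Sum>k<K. ennreal (c / (real k + 2)\<^sup>2)) = ennreal (c * (\<Sum>k<K. 1 / (real k + 2)\<^sup>2))"
      using that by (simp add: sum_distrib_left)
    also have "\<dots> \<le> ennreal (c * 1)"
      by (intro ennreal_leI mult_left_mono sum_inverse_squares_shift_le that)
    finally show ?thesis by simp
  qed
  then show ?thesis by (simp add: suminf_eq_SUP SUP_le_iff)
qed

section \<open>Independence of a block from its entry time, and failure of the strict bounds\<close>

context bandit
begin

text \<open>Two events that depend on complementary sets of coordinates are independent. Dependence
  is stated pointwise, through tapes that agree on the relevant coordinates, as is natural for
  events about runs.\<close>

lemma prob_inter_local:
  fixes K :: "(nat \<times> nat) set"
  assumes [measurable]: "Measurable.pred (tape n D) P" "Measurable.pred (tape n D) Q"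
    and K: "K \<subseteq> {..<n} \<times> UNIV"
    and P: "\<And>x x'. x \<in> space (tape n D) \<Longrightarrow> x' \<in> space (tape n D) \<Longrightarrow>
      \<forall>p\<in>{..<n} \<times> UNIV - K. x p = x' p \<Longrightarrow> P x \<Longrightarrow> P x'"
    and Q: "\<And>x x'. x \<in> space (tape n D) \<Longrightarrow> x' \<in> space (tape n D) \<Longrightarrow>
      \<forall>p\<in>K. x p = x' p \<Longrightarrow> Q x \<Longrightarrow> Q x'"
  shows "emeasure (tape n D) {x\<in>space (tape n D). P x \<and> Q x}
    = emeasure (tape n D) {x\<in>space (tape n D). P x} * emeasure (tape n D) {x\<in>space (tape n D). Q x}"
proof -
  let ?I = "{..<n} \<times> (UNIV :: nat set)" and ?T = "tape n D" and ?D = "\<lambda>p. D (fst p)"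
  obtain c where c: "c \<in> space ?T" using not_empty by auto
  \<comment> \<open>Filling the missing coordinates from a fixed tape \<open>c\<close> writes an
    event depending on \<open>J\<close> as the preimage of a measurable set under restriction to
    \<open>J\<close>.\<close>
  define ext where "ext J y = (\<lambda>p\<in>?I. if p \<in> J then y p else c p)" for J and y :: "nat \<times> nat \<Rightarrow> real"
  have ext: "ext J \<in> measurable (PiM J ?D) ?T" if "J \<subseteq> ?I" for J
    unfolding ext_def[abs_def] tape_def
  proof (rule measurable_restrict)
    fix p assume p: "p \<in> ?I"
    have "c p \<in> space (?D p)" using c p by (auto simp: tape_def space_PiM)
    then have "(\<lambda>y. c p) \<in> measurable (PiM J ?D) (?D p)" by (rule measurable_const)
    moreover have "(\<lambda>y. y p) \<in> measurable (PiM J ?D) (?D p)" if "p \<in> J"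
      by (rule measurable_component_singleton[OF that])
    ultimately show "(\<lambda>y. if p \<in> J then y p else c p) \<in> measurable (PiM J ?D) (?D p)"
      by (cases "p \<in> J") (simp_all only: if_True if_False)
  qed
  have rep: "\<exists>B\<in>sets (PiM J ?D). {x\<in>space ?T. R x} = (\<lambda>\<omega>. restrict (\<lambda>p. \<omega> p) J) -` B \<inter> space ?T"
    if J: "J \<subseteq> ?I" and [measurable]: "Measurable.pred ?T R"
      and R: "\<And>x x'. x \<in> space ?T \<Longrightarrow> x' \<in> space ?T \<Longrightarrow> \<forall>p\<in>J. x p = x' p \<Longrightarrow> R x \<Longrightarrow> R x'" for J R
  proof
    show "{y\<in>space (PiM J ?D). R (ext J y)} \<in> sets (PiM J ?D)"
      using measurable_compose[OF ext[OF J] \<open>Measurable.pred ?T R\<close>] by measurable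
    have "R x \<longleftrightarrow> R (ext J (restrict x J))" and "restrict x J \<in> space (PiM J ?D)" if x: "x \<in> space ?T" for x
    proof -
      show res: "restrict x J \<in> space (PiM J ?D)" using x J by (auto simp: tape_def space_PiM)
      have "ext J (restrict x J) \<in> space ?T" using measurable_space[OF ext[OF J] res] .
      moreover have "\<forall>p\<in>J. x p = ext J (restrict x J) p" "\<forall>p\<in>J. ext J (restrict x J) p = x p"
        using J by (auto simp: ext_def)
      ultimately show "R x \<longleftrightarrow> R (ext J (restrict x J))" using R x by blast
    qed
    then show "{x\<in>space ?T. R x} = (\<lambda>\<omega>. restrict (\<lambda>p. \<omega> p) J) -` {y\<in>space (PiM J ?D). R (ext J y)} \<inter> space ?T"
      by auto
  qed
  have "\<exists>B\<in>sets (PiM (?I - K) ?D). {x\<in>space ?T. P x} = (\<lambda>\<omega>. restrict (\<lambda>p. \<omega> p) (?I - K)) -` B \<inter> space ?T"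
    by (rule rep[OF Diff_subset assms(1)]) (rule P)
  then obtain B1 where B1: "B1 \<in> sets (PiM (?I - K) ?D)"
    "{x\<in>space ?T. P x} = (\<lambda>\<omega>. restrict (\<lambda>p. \<omega> p) (?I - K)) -` B1 \<inter> space ?T"
    by (elim bexE)
  have "\<exists>B\<in>sets (PiM K ?D). {x\<in>space ?T. Q x} = (\<lambda>\<omega>. restrict (\<lambda>p. \<omega> p) K) -` B \<inter> space ?T"
    by (rule rep[OF K assms(2)]) (rule Q)
  then obtain B2 where B2: "B2 \<in> sets (PiM K ?D)"
    "{x\<in>space ?T. Q x} = (\<lambda>\<omega>. restrict (\<lambda>p. \<omega> p) K) -` B2 \<inter> space ?T"
    by (elim bexE)
  have "indep_var (PiM (?I - K) ?D) (\<lambda>\<omega>. restrict (\<lambda>p. \<omega> p) (?I - K)) (PiM K ?D) (\<lambda>\<omega>. restrict (\<lambda>p. \<omega> p) K)"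
    by (rule indep_var_restrict[OF indep_coordinates]) (use K in auto)
  note indep = indep_varD[OF this B1(1) B2(1)]
  have "prob {x\<in>space ?T. P x \<and> Q x} = prob {x\<in>space ?T. P x} * prob {x\<in>space ?T. Q x}"
  proof (rule trans[OF _ indep[folded B1(2) B2(2)]])
    have "{x\<in>space ?T. P x \<and> Q x} = {x\<in>space ?T. P x} \<inter> {x\<in>space ?T. Q x}" by blast
    also have "\<dots> = (\<lambda>x. (restrict (\<lambda>p. x p) (?I - K), restrict (\<lambda>p. x p) K)) -` (B1 \<times> B2) \<inter> space ?T"
      unfolding B1(2) B2(2) by blast
    finally show "prob {x\<in>space ?T. P x \<and> Q x}
      = prob ((\<lambda>x. (restrict (\<lambda>p. x p) (?I - K), restrict (\<lambda>p. x p) K)) -` (B1 \<times> B2) \<inter> space ?T)"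
      by (rule arg_cong)
  qed
  then show ?thesis by (simp add: emeasure_eq_measure ennreal_mult)
qed

context
  fixes q u :: real
  assumes n: "2 \<le> n" and q: "1 \<le> q"
begin

lemma measurable_arms [measurable]:
  "(\<lambda>x. map fst (history (policy n q) u x t)) \<in> measurable (tape n D) (count_space UNIV)"
  unfolding measurable_count_space_eq2_countable
proof (intro conjI ballI)
  fix a :: "nat list"
  have "(\<lambda>x. map fst (history (policy n q) u x t)) -` {a} \<inter> space (tape n D)
    = {x\<in>space (tape n D). map fst (history (policy n q) u x t) = a}" by auto
  then show "(\<lambda>x. map fst (history (policy n q) u x t)) -` {a} \<inter> space (tape n D) \<in> events"
    by (simp only: predE[OF measurable_arms_history[OF n]])
qed simp

lemma measurable_reaches [measurable]:
  "Measurable.pred (tape n D) (\<lambda>x. reaches (policy n q) u x i N t)"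
proof -
  have 1: "pulls h i = count_list (map fst h) i" for h
    by (induction h) (auto simp: pulls_def)
  have 2: "length h = length (map fst h)" for h :: "(nat \<times> real) list" by simp
  show ?thesis
    unfolding reaches_def 1 2 by (measurable)
qed

text \<open>For a fixed entry time the level is a constant and independence multiplies the two
  probabilities. Keeping the entry event inside an integral prepares for the pathwise sum over arms
  and times.\<close>

lemma prob_reaches_not_concentrated:
  assumes i: "i < n"
  shows "emeasure (tape n D) {x\<in>space (tape n D). reaches (policy n q) u x i (2 ^ k) t \<and>
      \<not> concentrated k (\<lambda>s. x (i, s)) (mean (D i)) (var (D i)) (strict_level q k t)}
    \<le> ennreal (4 * exp (- q) / (real k + 2)\<^sup>2) *
      (\<integral>\<^sup>+x. (if reaches (policy n q) u x i (2 ^ k) t then ennreal ((real (2 ^ k) / real t)\<^sup>2) else 0) \<partial>tape n D)"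
    (is "emeasure ?T {x\<in>space ?T. ?P x \<and> ?Q x} \<le> _")
proof (cases "2 ^ k \<le> t")
  case False
  then have empty: "{x\<in>space ?T. ?P x \<and> ?Q x} = {}" using reaches_imp_le by fastforce
  show ?thesis unfolding empty by simp
next
  case True
  then have t: "0 < t" by (metis less_le_trans zero_less_numeral zero_less_power)
  have "(2::real) ^ k \<le> real t" using of_nat_mono[OF True, where ?'a = real] by simp
  then have "1 \<le> real t / 2 ^ k" by simp
  then have level: "0 \<le> strict_level q k t" using q by (simp add: strict_level_def level_def)
  \<comment> \<open>All observations of arm \<open>i\<close> from the block onwards: the block lies
    inside, and the entry event looks only outside.\<close>
  let ?K = "{i} \<times> {2 ^ k..}"
  have "emeasure ?T {x\<in>space ?T. ?P x \<and> ?Q x} = emeasure ?T {x\<in>space ?T. ?P x} * emeasure ?T {x\<in>space ?T. ?Q x}"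
  proof (rule prob_inter_local[where K = ?K])
    show "?K \<subseteq> {..<n} \<times> UNIV" using i by auto
    fix x x' assume x: "x \<in> space ?T" "x' \<in> space ?T"
    show "?P x'" if eq: "\<forall>p\<in>{..<n} \<times> UNIV - ?K. x p = x' p" and "?P x"
    proof (rule reaches_local[OF _ \<open>?P x\<close>])
      fix j s assume js: "j \<noteq> i \<or> s < (2::nat) ^ k"
      show "x (j, s) = x' (j, s)"
      proof (cases "j < n")
        case False
        then show ?thesis using x by (auto simp: tape_def space_PiM PiE_def extensional_def)
      qed (use eq js in auto)
    qed
    show "?Q x'" if eq: "\<forall>p\<in>?K. x p = x' p" and "?Q x"
      using \<open>?Q x\<close> eq by (subst block_stats_cong(3)[where y' = "\<lambda>s. x (i, s)"]) (auto simp: block_def)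
  qed (use i in measurable)
  also have "\<dots> \<le> emeasure ?T {x\<in>space ?T. ?P x} * ennreal (4 * exp (- strict_level q k t))"
    by (intro mult_left_mono prob_not_concentrated i level) simp
  also have "\<dots> = ennreal (4 * exp (- q) / (real k + 2)\<^sup>2) *
      (ennreal ((real (2 ^ k) / real t)\<^sup>2) * emeasure ?T {x\<in>space ?T. ?P x})"
  proof -
    have "ennreal (4 * exp (- strict_level q k t))
      = ennreal (4 * exp (- q) / (real k + 2)\<^sup>2) * ennreal ((real (2 ^ k) / real t)\<^sup>2)"
      by (subst ennreal_mult'[symmetric]) (simp_all add: exp_minus_strict_level[OF t])
    then show ?thesis by (simp only: mult_ac)
  qed
  also have "ennreal ((real (2 ^ k) / real t)\<^sup>2) * emeasure ?T {x\<in>space ?T. ?P x}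
      = (\<integral>\<^sup>+x. (if ?P x then ennreal ((real (2 ^ k) / real t)\<^sup>2) else 0) \<partial>?T)"
    by (subst nn_integral_cmult_indicator[symmetric])
      (auto intro!: nn_integral_cong simp: indicator_def)
  finally show ?thesis .
qed

text \<open>After exchanging sums and integral, the sum over arms and times is at most 2 on every
  tape by the rank argument; no factor depending on \<open>n\<close> appears. Summing over
  \<open>k\<close> uses the inverse squares in the level.\<close>

lemma prob_strict_failure:
  "emeasure (tape n D) {x\<in>space (tape n D). \<exists>k. \<exists>i<n. \<exists>t. reaches (policy n q) u x i (2 ^ k) t \<and>
      \<not> concentrated k (\<lambda>s. x (i, s)) (mean (D i)) (var (D i)) (strict_level q k t)}
    \<le> ennreal (8 * exp (- q))"
proof -
  let ?T = "tape n D"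
  let ?F = "\<lambda>k i t. {x\<in>space ?T. reaches (policy n q) u x i (2 ^ k) t \<and>
      \<not> concentrated k (\<lambda>s. x (i, s)) (mean (D i)) (var (D i)) (strict_level q k t)}"
  let ?w = "\<lambda>k i t x. if reaches (policy n q) u x i (2 ^ k) t then ennreal ((real (2 ^ k) / real t)\<^sup>2) else 0"
  let ?c = "\<lambda>k. ennreal (4 * exp (- q) / (real k + 2)\<^sup>2)"
  have F: "?F k i t \<in> sets ?T" if "i < n" for k i t
    using that by measurable
  have FU: "(\<Union>t. ?F k i t) \<in> sets ?T" if "i < n" for k i
    using F[OF that] by (intro sets.countable_UN) auto
  have w: "?w k i t \<in> borel_measurable ?T" for k i t by measurable
  have eq: "{x\<in>space ?T. \<exists>k. \<exists>i<n. \<exists>t. reaches (policy n q) u x i (2 ^ k) t \<and>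
      \<not> concentrated k (\<lambda>s. x (i, s)) (mean (D i)) (var (D i)) (strict_level q k t)}
    = (\<Union>k. \<Union>i\<in>{..<n}. \<Union>t. ?F k i t)" by blast
  have "emeasure ?T (\<Union>k. \<Union>i\<in>{..<n}. \<Union>t. ?F k i t) \<le> (\<Sum>k. emeasure ?T (\<Union>i\<in>{..<n}. \<Union>t. ?F k i t))"
    by (rule emeasure_subadditive_countably) (use FU in \<open>blast intro: sets.finite_UN\<close>)
  also have "\<dots> \<le> (\<Sum>k. ?c k * (\<integral>\<^sup>+x. (\<Sum>i<n. \<Sum>t. ?w k i t x) \<partial>?T))"
  proof (rule suminf_le[OF _ summableI summableI])
    fix k
    have "emeasure ?T (\<Union>i\<in>{..<n}. \<Union>t. ?F k i t) \<le> (\<Sum>i<n. emeasure ?T (\<Union>t. ?F k i t))"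
      by (rule emeasure_subadditive_finite) (use FU in blast)+
    also have "\<dots> \<le> (\<Sum>i<n. \<Sum>t. emeasure ?T (?F k i t))"
      by (rule sum_mono, rule emeasure_subadditive_countably) (use F in blast)
    also have "\<dots> \<le> (\<Sum>i<n. \<Sum>t. ?c k * (\<integral>\<^sup>+x. ?w k i t x \<partial>?T))"
      by (rule sum_mono, rule suminf_le[OF _ summableI summableI], rule prob_reaches_not_concentrated) simp
    also have "\<dots> = ?c k * (\<Sum>i<n. \<Sum>t. \<integral>\<^sup>+x. ?w k i t x \<partial>?T)"
      by (simp only: ennreal_suminf_cmult sum_distrib_left)
    also have "\<dots> = ?c k * (\<integral>\<^sup>+x. (\<Sum>i<n. \<Sum>t. ?w k i t x) \<partial>?T)"
    proof (rule arg_cong[where f = "(*) (?c k)"])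
      have "(\<Sum>i<n. \<Sum>t. \<integral>\<^sup>+x. ?w k i t x \<partial>?T) = (\<Sum>i<n. \<integral>\<^sup>+x. (\<Sum>t. ?w k i t x) \<partial>?T)"
        by (rule sum.cong[OF refl], rule nn_integral_suminf[symmetric], rule w)
      also have "\<dots> = (\<integral>\<^sup>+x. (\<Sum>i<n. \<Sum>t. ?w k i t x) \<partial>?T)"
        by (rule nn_integral_sum[symmetric], rule borel_measurable_suminf_order, rule w)
      finally show "(\<Sum>i<n. \<Sum>t. \<integral>\<^sup>+x. ?w k i t x \<partial>?T) = (\<integral>\<^sup>+x. (\<Sum>i<n. \<Sum>t. ?w k i t x) \<partial>?T)" .
    qed
    finally show "emeasure ?T (\<Union>i\<in>{..<n}. \<Union>t. ?F k i t)
      \<le> ?c k * (\<integral>\<^sup>+x. (\<Sum>i<n. \<Sum>t. ?w k i t x) \<partial>?T)" .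
  qed
  also have "\<dots> \<le> (\<Sum>k. ?c k * 2)"
  proof (rule suminf_le[OF _ summableI summableI], rule mult_left_mono)
    fix k
    have "(\<integral>\<^sup>+x. (\<Sum>i<n. \<Sum>t. ?w k i t x) \<partial>?T) \<le> (\<integral>\<^sup>+x. 2 \<partial>?T)"
      by (rule nn_integral_mono, rule suminf_reaches_le[OF valid_policy_policy[OF n]]) simp
    then show "(\<integral>\<^sup>+x. (\<Sum>i<n. \<Sum>t. ?w k i t x) \<partial>?T) \<le> 2" by (simp add: emeasure_space_1)
  qed simp
  also have "\<dots> = (\<Sum>k. ?c k) * 2" by simp
  also have "\<dots> \<le> ennreal (4 * exp (- q)) * 2"
    by (intro mult_right_mono suminf_inverse_squares_le) auto
  also have "\<dots> = ennreal (8 * exp (- q))"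
    by (simp add: ennreal_mult'[symmetric] flip: ennreal_numeral)
  finally show ?thesis unfolding eq .
qed

end

lemma prob_some_block_not_concentrated:
  assumes i: "i < n" and z: "0 \<le> z"
  shows "emeasure (tape n D) {x\<in>space (tape n D). \<exists>k. \<not> concentrated k (\<lambda>s. x (i, s)) (mean (D i)) (var (D i)) (level z k)}
    \<le> ennreal (4 * exp (- z))"
proof -
  let ?T = "tape n D"
  let ?F = "\<lambda>k. {x\<in>space ?T. \<not> concentrated k (\<lambda>s. x (i, s)) (mean (D i)) (var (D i)) (level z k)}"
  have [measurable]: "?F k \<in> sets ?T" for k using i by measurable
  have "{x\<in>space ?T. \<exists>k. \<not> concentrated k (\<lambda>s. x (i, s)) (mean (D i)) (var (D i)) (level z k)} = (\<Union>k. ?F k)"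
    by auto
  also have "emeasure ?T \<dots> \<le> (\<Sum>k. emeasure ?T (?F k))"
    by (rule emeasure_subadditive_countably) auto
  also have "\<dots> \<le> (\<Sum>k. ennreal (4 * exp (- z) / (real k + 2)\<^sup>2))"
  proof (intro suminf_le summableI)
    fix k
    have "0 \<le> level z k" using z by (simp add: level_def)
    from prob_not_concentrated[OF i this, of k]
    show "emeasure ?T (?F k) \<le> ennreal (4 * exp (- z) / (real k + 2)\<^sup>2)"
      by (simp only: exp_minus_level times_divide_eq_right)
  qed
  also have "\<dots> \<le> ennreal (4 * exp (- z))"
    by (intro suminf_inverse_squares_le) simp
  finally show ?thesis .
qed

end

text \<open>All indices below the first non-failing one are counted by the sum, and its finiteness
  guarantees that a non-failing one exists.\<close>

lemma first_failure_le_suminf: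
  assumes "(\<Sum>m. if f m then 1 else 0 :: ennreal) < \<infinity>"
  shows "\<exists>r. \<not> f r \<and> of_nat r \<le> (\<Sum>m. if f m then 1 else 0 :: ennreal)"
proof -
  have *: "of_nat r \<le> (\<Sum>m. if f m then 1 else 0 :: ennreal)" if "\<And>m. m < r \<Longrightarrow> f m" for r
  proof -
    have "(\<Sum>m<r. if f m then 1 else 0 :: ennreal) = (\<Sum>m<r. 1)"
      by (rule sum.cong) (use that in auto)
    then have "of_nat r = (\<Sum>m<r. if f m then 1 else 0 :: ennreal)" by simp
    also have "\<dots> \<le> (\<Sum>m. if f m then 1 else 0)" by (rule sum_le_suminf) auto
    finally show ?thesis .
  qed
  have "\<exists>r. \<not> f r"
  proof (rule ccontr)
    assume "\<not> ?thesis"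
    then have "of_nat r \<le> (\<Sum>m. if f m then 1 else 0 :: ennreal)" for r by (intro *) auto
    moreover obtain r where "(\<Sum>m. if f m then 1 else 0 :: ennreal) < of_nat r"
      using ennreal_Ex_less_of_nat[OF assms[unfolded infinity_ennreal_def]] by blast
    ultimately show False by (meson not_less)
  qed
  then have "\<not> f (LEAST r. \<not> f r)" by (rule LeastI_ex)
  moreover have "of_nat (LEAST r. \<not> f r) \<le> (\<Sum>m. if f m then 1 else 0 :: ennreal)"
    by (rule *) (use not_less_Least in blast)
  ultimately show ?thesis by blast
qed

lemma policy_seed: "policy n q u = policy n q 0"
  by (simp add: policy_def fun_eq_iff)

lemma history_seed: "history (policy n q) u x t = history (policy n q) 0 x t"
  by (induction t) (simp_all add: history_Suc step_def policy_seed[of n q u])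

section \<open>The weighted cost of failing levels\<close>

context bandit
begin

definition fails :: "nat \<Rightarrow> real \<Rightarrow> (nat \<times> nat \<Rightarrow> real) \<Rightarrow> bool" where
  "fails i z x \<longleftrightarrow> (\<exists>k. \<not> concentrated k (\<lambda>s. x (i, s)) (mean (D i)) (var (D i)) (level z k))"

lemma measurable_fails [measurable]: "i < n \<Longrightarrow> Measurable.pred (tape n D) (fails i z)"
  unfolding fails_def[abs_def] by measurable

text \<open>Counting all failing levels, instead of taking the first good one, keeps the quantity
  measurable and additive while still dominating the first good level. Values lie in
  \<open>ennreal\<close> since the count may be infinite.\<close>

definition excess :: "(nat \<Rightarrow> real) \<Rightarrow> real \<Rightarrow> (nat \<times> nat \<Rightarrow> real) \<Rightarrow> ennreal" where
  "excess w q x = (\<Sum>i<n. ennreal (w i) * (\<Sum>m. if fails i (q + real m) x then 1 else 0))"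

lemma measurable_excess [measurable]: "excess w q \<in> borel_measurable (tape n D)"
  unfolding excess_def[abs_def]
  by (intro borel_measurable_sum borel_measurable_times_ennreal borel_measurable_const borel_measurable_suminf_order
      measurable_If measurable_fails) auto

lemma suminf_exp_le: "(\<Sum>m. ennreal (4 * exp (- (q + real m)))) \<le> ennreal (8 * exp (- q))"
proof -
  have "(\<Sum>m. ennreal (4 * exp (- (q + real m)))) \<le> (\<Sum>m. ennreal (4 * exp (- q) * (1 / 2) ^ m))"
  proof (rule suminf_le[OF _ summableI summableI], rule ennreal_leI)
    fix m
    have "exp (- real m) = (1 / exp 1) ^ m"
      by (simp add: exp_minus power_one_over inverse_eq_divide flip: exp_of_nat_mult)
    also have "\<dots> \<le> (1 / 2 :: real) ^ m"
      using exp_ge_add_one_self[of 1] by (intro power_mono divide_left_mono) auto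
    finally have "exp (- q) * exp (- real m) \<le> exp (- q) * (1 / 2) ^ m" by (rule mult_left_mono) simp
    then show "4 * exp (- (q + real m)) \<le> 4 * exp (- q) * (1 / 2) ^ m"
      by (simp add: exp_add[symmetric])
  qed
  also have "\<dots> = ennreal (4 * exp (- q) * 2)"
  proof (rule suminf_ennreal_eq)
    have "(\<lambda>m. (1 / 2 :: real) ^ m) sums 2" using geometric_sums[of "1 / 2 :: real"] by simp
    then show "(\<lambda>m. 4 * exp (- q) * (1 / 2) ^ m) sums (4 * exp (- q) * 2)" by (rule sums_mult)
  qed simp
  finally show ?thesis by (simp add: mult.commute)
qed

lemma nn_integral_excess:
  assumes q: "0 \<le> q" and w: "\<And>i. i < n \<Longrightarrow> 0 \<le> w i"
  shows "(\<integral>\<^sup>+x. excess w q x \<partial>tape n D) \<le> ennreal (\<Sum>i<n. w i) * ennreal (8 * exp (- q))"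
proof -
  let ?T = "tape n D"
  have meas: "(\<lambda>x. if fails i (q + real m) x then 1 else 0 :: ennreal) \<in> borel_measurable ?T" if "i < n" for i m
    by (intro measurable_If predE[OF measurable_fails[OF that]]) auto
  have "(\<integral>\<^sup>+x. excess w q x \<partial>?T)
    = (\<Sum>i<n. \<integral>\<^sup>+x. ennreal (w i) * (\<Sum>m. if fails i (q + real m) x then 1 else 0) \<partial>?T)"
    unfolding excess_def
    by (intro nn_integral_sum borel_measurable_times_ennreal borel_measurable_const borel_measurable_suminf_order meas) auto
  also have "\<dots> = (\<Sum>i<n. ennreal (w i) * (\<Sum>m. \<integral>\<^sup>+x. (if fails i (q + real m) x then 1 else 0) \<partial>?T))"
  proof (rule sum.cong[OF refl])
    fix i assume "i \<in> {..<n}"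
    then have m: "(\<lambda>x. if fails i (q + real m) x then 1 else 0 :: ennreal) \<in> borel_measurable ?T" for m
      by (intro meas) simp
    have "(\<integral>\<^sup>+x. ennreal (w i) * (\<Sum>m. if fails i (q + real m) x then 1 else 0) \<partial>?T)
      = ennreal (w i) * (\<integral>\<^sup>+x. (\<Sum>m. if fails i (q + real m) x then 1 else 0) \<partial>?T)"
      by (rule nn_integral_cmult, rule borel_measurable_suminf_order, rule m)
    then show "(\<integral>\<^sup>+x. ennreal (w i) * (\<Sum>m. if fails i (q + real m) x then 1 else 0) \<partial>?T)
      = ennreal (w i) * (\<Sum>m. \<integral>\<^sup>+x. (if fails i (q + real m) x then 1 else 0) \<partial>?T)"
      by (simp only: nn_integral_suminf[OF m])
  qed
  also have "\<dots> \<le> (\<Sum>i<n. ennreal (w i) * ennreal (8 * exp (- q)))"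
  proof (rule sum_mono, rule mult_left_mono)
    fix i assume "i \<in> {..<n}"
    then have i: "i < n" by simp
    have "(\<integral>\<^sup>+x. (if fails i (q + real m) x then 1 else 0) \<partial>?T) \<le> ennreal (4 * exp (- (q + real m)))" for m
    proof -
      have "(\<integral>\<^sup>+x. (if fails i (q + real m) x then 1 else 0) \<partial>?T)
        = (\<integral>\<^sup>+x. indicator {x\<in>space ?T. fails i (q + real m) x} x \<partial>?T)"
        by (intro nn_integral_cong) (auto simp: indicator_def)
      also have "\<dots> = emeasure ?T {x\<in>space ?T. fails i (q + real m) x}"
        by (rule nn_integral_indicator) (rule predE[OF measurable_fails[OF i]])
      also have "\<dots> \<le> ennreal (4 * exp (- (q + real m)))"
        unfolding fails_def by (rule prob_some_block_not_concentrated[OF i]) (use q in simp)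
      finally show ?thesis .
    qed
    then have "(\<Sum>m. \<integral>\<^sup>+x. (if fails i (q + real m) x then 1 else 0) \<partial>?T)
      \<le> (\<Sum>m. ennreal (4 * exp (- (q + real m))))"
      by (intro suminf_le summableI)
    also have "\<dots> \<le> ennreal (8 * exp (- q))" by (rule suminf_exp_le)
    finally show "(\<Sum>m. \<integral>\<^sup>+x. (if fails i (q + real m) x then 1 else 0) \<partial>?T) \<le> ennreal (8 * exp (- q))" .
  qed simp
  also have "\<dots> = ennreal (\<Sum>i<n. w i) * ennreal (8 * exp (- q))"
  proof -
    have "(\<Sum>i<n. ennreal (w i)) = ennreal (\<Sum>i<n. w i)" by (rule sum_ennreal) (use w in simp)
    then show ?thesis by (simp only: sum_distrib_right[symmetric])
  qed
  finally show ?thesis .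
qed

text \<open>Markov's inequality. The failure probabilities decay geometrically in \<open>m\<close>,
  so the expectation is at most the total weight times \<open>8 * exp (- q)\<close>.\<close>

lemma prob_excess:
  assumes q: "0 \<le> q" and w: "\<And>i. i < n \<Longrightarrow> 0 < w i"
  shows "emeasure (tape n D) {x\<in>space (tape n D). ennreal (\<Sum>i<n. w i) \<le> excess w q x} \<le> ennreal (8 * exp (- q))"
proof -
  let ?T = "tape n D" and ?W = "\<Sum>i<n. w i"
  have W: "0 < ?W" using n_pos w by (intro sum_pos) auto
  have cancel: "ennreal (1 / ?W) * (ennreal ?W * z) = z" for z
    using W by (simp add: mult.assoc[symmetric] ennreal_mult'[symmetric])
  have "1 \<le> ennreal (1 / ?W) * excess w q x" if "ennreal ?W \<le> excess w q x" for x
    using mult_left_mono[OF that, of "ennreal (1 / ?W)"] cancel[of 1] by simp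
  then have "emeasure ?T {x\<in>space ?T. ennreal ?W \<le> excess w q x}
      \<le> emeasure ?T {x\<in>space ?T. 1 \<le> ennreal (1 / ?W) * excess w q x}"
    by (intro emeasure_mono) auto
  also have "\<dots> \<le> ennreal (1 / ?W) * (\<integral>\<^sup>+x. excess w q x * indicator (space ?T) x \<partial>?T)"
    by (rule nn_integral_Markov_inequality) auto
  also have "(\<integral>\<^sup>+x. excess w q x * indicator (space ?T) x \<partial>?T) = (\<integral>\<^sup>+x. excess w q x \<partial>?T)"
    by (intro nn_integral_cong) auto
  also have "ennreal (1 / ?W) * (\<integral>\<^sup>+x. excess w q x \<partial>?T) \<le> ennreal (1 / ?W) * (ennreal ?W * ennreal (8 * exp (- q)))"
    by (intro mult_left_mono nn_integral_excess q) (use w in \<open>auto intro: less_imp_le\<close>)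
  also have "\<dots> = ennreal (8 * exp (- q))" by (rule cancel)
  finally show ?thesis .
qed

text \<open>Supplies the function \<open>r\<close> of \<open>good_tape\<close>: each arm takes its
  first non-failing level, and the weighted sum of these levels is at most the total weight.\<close>

lemma excess_less_imp:
  assumes w: "\<And>i. i < n \<Longrightarrow> 0 < w i" and less: "excess w q x < ennreal (\<Sum>i<n. w i)"
  shows "\<exists>r. (\<forall>i<n. \<not> fails i (q + real (r i)) x) \<and> (\<Sum>i<n. w i * real (r i)) \<le> (\<Sum>i<n. w i)"
proof -
  let ?R = "\<lambda>i. \<Sum>m. if fails i (q + real m) x then 1 else 0 :: ennreal"
  have "\<exists>r. \<not> fails i (q + real r) x \<and> of_nat r \<le> ?R i" if i: "i < n" for i
  proof (rule first_failure_le_suminf)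
    have "ennreal (w i) * ?R i \<le> excess w q x"
      unfolding excess_def by (rule member_le_sum) (use i in auto)
    also have "\<dots> < \<infinity>" using less by (rule less_trans) simp
    finally show "?R i < \<infinity>"
      using w[OF i] by (auto simp: ennreal_mult_less_top less_top[symmetric] ennreal_mult_eq_top_iff)
  qed
  then obtain r where r: "\<And>i. i < n \<Longrightarrow> \<not> fails i (q + real (r i)) x" "\<And>i. i < n \<Longrightarrow> of_nat (r i) \<le> ?R i"
    by metis
  have "ennreal (\<Sum>i<n. w i * real (r i)) = (\<Sum>i<n. ennreal (w i) * of_nat (r i))"
    using w by (subst sum_ennreal[symmetric])
      (auto intro!: sum.cong simp: ennreal_mult ennreal_of_nat_eq_real_of_nat less_imp_le)
  also have "\<dots> \<le> excess w q x"
    unfolding excess_def by (intro sum_mono mult_left_mono r(2)) auto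
  finally have "ennreal (\<Sum>i<n. w i * real (r i)) \<le> ennreal (\<Sum>i<n. w i)" using less by simp
  moreover have "0 \<le> (\<Sum>i<n. w i)" using w by (intro sum_nonneg) (auto intro: less_imp_le)
  ultimately have "(\<Sum>i<n. w i * real (r i)) \<le> (\<Sum>i<n. w i)" by (simp only: ennreal_le_iff)
  then show ?thesis using r(1) by blast
qed

section \<open>From tapes to the success probability\<close>

lemma measurable_success:
  assumes n: "2 \<le> n"
  shows "Measurable.pred (tape n D) (\<lambda>x. \<exists>t. policy n q u (history (policy n q) u x t) = Stop b \<and>
    real (length (history (policy n q) u x t)) \<le> B)"
proof -
  have "policy n q u (history (policy n q) u x t) = Stop b \<and> real (length (history (policy n q) u x t)) \<le> B \<longleftrightarrow>
    (\<exists>a. map fst (history (policy n q) u x t) = a \<and> policy n q u (replay x a) = Stop b \<and> real (length a) \<le> B)" for x t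
    using history_replay[of "policy n q" u x t] length_map[of fst "history (policy n q) u x t"] by metis
  note * = this
  note [measurable] = measurable_arms_history[OF n] measurable_policy_replay[OF n]
  show ?thesis unfolding * by measurable
qed

text \<open>The policy is deterministic, so the event is the product of the seed space and a tape
  event.\<close>

lemma measure_success_event:
  assumes n: "2 \<le> n"
  shows "measure (outcome_space n D) (success_event n D (policy n q) b B)
    = prob {x\<in>space (tape n D). \<exists>t. policy n q 0 (history (policy n q) 0 x t) = Stop b \<and>
        real (length (history (policy n q) 0 x t)) \<le> B}"
    (is "_ = prob ?S")
proof -
  let ?U = "uniform_measure lborel {0..1::real}"
  have U: "prob_space ?U" by (rule prob_space_uniform_measure) auto
  have "(u, x) \<in> success_event n D (policy n q) b B \<longleftrightarrow> (u, x) \<in> space ?U \<times> ?S" for u x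
    by (simp add: success_event_def outcome_space_def tape_def space_pair_measure
        policy_seed[of n q u] history_seed[of n q u])
  then have "success_event n D (policy n q) b B = space ?U \<times> ?S"
    by (intro subset_antisym subrelI) (simp_all only:)
  moreover have "?S \<in> events" using predE[OF measurable_success[OF n]] .
  then have "emeasure (?U \<Otimes>\<^sub>M tape n D) (space ?U \<times> ?S) = emeasure ?U (space ?U) * emeasure (tape n D) ?S"
    by (intro emeasure_pair_measure_Times) auto
  ultimately show ?thesis
    using prob_space.emeasure_space_1[OF U] by (simp add: measure_def outcome_space_def tape_def)
qed

text \<open>Outside the three events \<open>E1\<close>, \<open>E2\<close>, \<open>E3\<close>, of
  total probability at most \<open>(4 + 8 + 8) * exp (- q)\<close>, the tape satisfies
  \<open>good_tape\<close>.\<close>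

lemma prob_success:
  assumes n: "2 \<le> n" and b: "b < n" and best: "\<forall>j<n. j \<noteq> b \<longrightarrow> mean (D j) < mean (D b)"
    and q: "1 \<le> q" and L: "q + 7 \<le> 19 * L" and d: "d = gap n (\<lambda>i. mean (D i)) b"
  shows "1 - 20 * exp (- q) \<le> measure (outcome_space n D) (success_event n D (policy n q) b
    (57066880 * (\<Sum>i<n. (var (D i) / (d i)\<^sup>2 + 1 / d i) * (L + LL (1 / d i)))))"
proof -
  let ?T = "tape n D" and ?\<theta> = "\<lambda>i. mean (D i)" and ?v = "\<lambda>i. var (D i)"
  define w where "w i = ?v i / (d i)\<^sup>2 + 1 / d i" for i
  let ?B = "57066880 * (\<Sum>i<n. w i * (L + LL (1 / d i)))"
  have v: "0 \<le> ?v i" "?v i \<le> 1" and m: "0 \<le> ?\<theta> i" "?\<theta> i \<le> 1" if "i < n" for i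
    using unit_distribution.var_bounds unit_distribution.mean_bounds unit_distribution_arm[OF that] by auto
  have gap: "d i = ?\<theta> b - ?\<theta> i" if "i \<noteq> b" for i using that by (simp add: d gap_def)
  let ?G = "{?\<theta> b - ?\<theta> j | j. j < n \<and> j \<noteq> b}"
  have "?G = (\<lambda>j. ?\<theta> b - ?\<theta> j) ` ({..<n} - {b})" by auto
  then have fin: "finite ?G" by simp
  have "(if b = 0 then 1 else 0) < n" "(if b = 0 then 1 else 0) \<noteq> b" using n by auto
  then have ne: "?G \<noteq> {}" by blast
  have db: "d b = Min ?G" by (simp add: d gap_def)
  have gap_b: "d b \<le> d i" if "i < n" for i
  proof (cases "i = b")
    case False
    then show ?thesis using that fin unfolding db gap[OF False] by (intro Min_le) auto
  qed simp
  \<comment> \<open>The gap assigned to the best arm is attained at another arm, from which it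
    inherits positivity and the bound 1.\<close>
  obtain j where j: "j < n" "j \<noteq> b" "d b = d j"
    using Min_in[OF fin ne] gap unfolding db[symmetric] by auto
  have d_pos: "0 < d i" and d_le: "d i \<le> 1" if i: "i < n" for i
  proof -
    have "0 < d l \<and> d l \<le> 1" if "l < n" "l \<noteq> b" for l
      using best m[OF that(1)] m[OF b] gap[OF that(2)] that by force
    then have "0 < d i \<and> d i \<le> 1" using i j by (cases "i = b") auto
    then show "0 < d i" "d i \<le> 1" by auto
  qed
  have w: "0 < w i" if "i < n" for i
    using v(1)[OF that] d_pos[OF that] by (auto simp: w_def intro: add_nonneg_pos)
  let ?E1 = "{x\<in>space ?T. fails b q x}"
  let ?E2 = "{x\<in>space ?T. ennreal (\<Sum>i<n. w i) \<le> excess w q x}"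
  let ?E3 = "{x\<in>space ?T. \<exists>k. \<exists>i<n. \<exists>t. reaches (policy n q) 0 x i (2 ^ k) t \<and>
      \<not> concentrated k (\<lambda>s. x (i, s)) (mean (D i)) (var (D i)) (strict_level q k t)}"
  let ?S = "{x\<in>space ?T. \<exists>t. policy n q 0 (history (policy n q) 0 x t) = Stop b \<and>
        real (length (history (policy n q) 0 x t)) \<le> ?B}"
  have E1: "?E1 \<in> events" using predE[OF measurable_fails[OF b]] by simp
  have E2: "?E2 \<in> events" by measurable
  have E3: "?E3 \<in> events"
  proof -
    have "?E3 = (\<Union>k. \<Union>i\<in>{..<n}. \<Union>t. {x\<in>space ?T. reaches (policy n q) 0 x i (2 ^ k) t \<and>
      \<not> concentrated k (\<lambda>s. x (i, s)) (mean (D i)) (var (D i)) (strict_level q k t)})" by blast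
    also have "\<dots> \<in> events"
    proof (intro sets.countable_UN sets.finite_UN image_subsetI ballI)
      fix k i t assume "i \<in> {..<n}"
      then have [measurable]: "i < n" by simp
      note [measurable] = measurable_reaches[OF n q]
      show "{x\<in>space ?T. reaches (policy n q) 0 x i (2 ^ k) t \<and>
        \<not> concentrated k (\<lambda>s. x (i, s)) (mean (D i)) (var (D i)) (strict_level q k t)} \<in> events"
        by measurable
    qed
    finally show ?thesis .
  qed
  have S: "?S \<in> events" using predE[OF measurable_success[OF n]] .
  have "x \<in> ?S" if x: "x \<in> space ?T" "x \<notin> ?E1 \<union> ?E2 \<union> ?E3" for x
  proof -
    have "excess w q x < ennreal (\<Sum>i<n. w i)" using x by (auto simp: not_le)
    from excess_less_imp[OF w this] obtain r
      where r: "\<And>i. i < n \<Longrightarrow> \<not> fails i (q + real (r i)) x" and sum_r: "(\<Sum>i<n. w i * real (r i)) \<le> (\<Sum>i<n. w i)"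
      by blast
    interpret good_tape n b q 0 x ?\<theta> ?v d r
    proof
      show "concentrated k (\<lambda>s. x (b, s)) (?\<theta> b) (?v b) (level q k)" for k
        using x by (auto simp: fails_def)
      show "concentrated k (\<lambda>s. x (i, s)) (?\<theta> i) (?v i) (level (q + real (r i)) k)" if "i < n" for i k
        using r[OF that] by (auto simp: fails_def)
      show "concentrated k (\<lambda>s. x (i, s)) (?\<theta> i) (?v i) (strict_level q k t)"
        if "i < n" "reaches (policy n q) 0 x i (2 ^ k) t" for i k t
        using x that by blast
    qed (use n b q v d_pos d_le gap gap_b in auto)
    have "10 * total_budget = 3003520 * (\<Sum>i<n. w i * (q + 6 + LL (1 / d i)) + w i * real (r i))"
      unfolding budget_def w_def sum_distrib_left by (intro sum.cong refl) (simp only: distrib_left distrib_right; algebra)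
    \<comment> \<open>The extra levels cost at most one more total weight, which raises 6 to
      7.\<close>
    also have "(\<Sum>i<n. w i * (q + 6 + LL (1 / d i)) + w i * real (r i))
      \<le> (\<Sum>i<n. w i * (q + 6 + LL (1 / d i))) + (\<Sum>i<n. w i)"
      using sum_r by (simp add: sum.distrib)
    also have "\<dots> = (\<Sum>i<n. w i * (q + 7 + LL (1 / d i)))"
      unfolding sum.distrib[symmetric] by (intro sum.cong refl) (simp add: algebra_simps)
    \<comment> \<open>Hence the final constant \<open>19 * 3003520 = 57066880\<close>.\<close>
    also have "\<dots> \<le> (\<Sum>i<n. 19 * (w i * (L + LL (1 / d i))))"
    proof (rule sum_mono)
      fix i assume "i \<in> {..<n}"
      then have i: "i < n" by simp
      have "w i * (q + 7 + LL (1 / d i)) \<le> w i * (19 * (L + LL (1 / d i)))"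
        using L LL_ge_one[OF d_pos[OF i] d_le[OF i]] less_imp_le[OF w[OF i]] by (intro mult_left_mono) auto
      then show "w i * (q + 7 + LL (1 / d i)) \<le> 19 * (w i * (L + LL (1 / d i)))"
        by (simp only: mult.left_commute)
    qed
    finally have "10 * total_budget \<le> ?B" by (simp add: sum_distrib_left[symmetric])
    then show "x \<in> ?S" using stops_with_best x(1) order_trans by blast
  qed
  then have "space ?T - ?S \<subseteq> ?E1 \<union> ?E2 \<union> ?E3" by blast
  then have "emeasure ?T (space ?T - ?S) \<le> emeasure ?T (?E1 \<union> ?E2 \<union> ?E3)"
    by (rule emeasure_mono) (intro sets.Un E1 E2 E3)
  also have "\<dots> \<le> emeasure ?T ?E1 + emeasure ?T ?E2 + emeasure ?T ?E3"
    by (intro order_trans[OF emeasure_subadditive] add_mono order_refl sets.Un E1 E2 E3)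
  also have "\<dots> \<le> ennreal (4 * exp (- q)) + ennreal (8 * exp (- q)) + ennreal (8 * exp (- q))"
  proof (intro add_mono)
    show "emeasure ?T ?E1 \<le> ennreal (4 * exp (- q))"
      unfolding fails_def by (rule prob_some_block_not_concentrated[OF b]) (use q in simp)
    show "emeasure ?T ?E2 \<le> ennreal (8 * exp (- q))"
      by (rule prob_excess) (use q w in auto)
    show "emeasure ?T ?E3 \<le> ennreal (8 * exp (- q))"
      by (rule prob_strict_failure[OF n q])
  qed
  also have "\<dots> = ennreal (20 * exp (- q))" by (simp flip: ennreal_plus)
  finally have "prob (space ?T - ?S) \<le> 20 * exp (- q)" by (simp add: emeasure_eq_measure)
  then have "1 - 20 * exp (- q) \<le> prob ?S" using prob_compl[OF S] by simp
  then show ?thesis unfolding measure_success_event[OF n] w_def .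
qed

end

theorem theorem5p1:
  shows "\<exists>C>0. \<forall>n\<ge>2. \<forall>\<delta>::real. 0 < \<delta> \<and> \<delta> \<le> 1/2 \<longrightarrow>
    (\<exists>A. valid_policy n A \<and>
      (\<forall>D b. bandit_instance n D \<and> b < n \<and> (\<forall>j<n. j \<noteq> b \<longrightarrow> mean (D j) < mean (D b)) \<longrightarrow>
        (let \<theta> = (\<lambda>i. mean (D i)); \<Delta> = gap n \<theta> b in
         measure (outcome_space n D)
           (success_event n D A b
              (C * (\<Sum>i<n. (var (D i) / (\<Delta> i)^2 + 1 / \<Delta> i) * (ln (1/\<delta>) + LL (1 / \<Delta> i)))))
         \<ge> 1 - \<delta>)))"
proof (intro exI[of _ 57066880] conjI allI impI)
  fix n :: nat and \<delta> :: real
  assume n: "2 \<le> n" and \<delta>: "0 < \<delta> \<and> \<delta> \<le> 1 / 2"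
  define L where "L = ln (1 / \<delta>)"
  \<comment> \<open>This \<open>q\<close> makes the failure probability
    \<open>20 * exp (- q)\<close> equal to \<delta>.\<close>
  define q where "q = ln (20 / \<delta>)"
  have "2 \<le> 1 / \<delta>" using \<delta> by (simp add: field_simps)
  then have "ln 2 \<le> L" unfolding L_def using \<delta> by (subst ln_le_cancel_iff) auto
  then have L: "2 / 3 \<le> L" using ln2_ge_two_thirds by linarith
  have q_eq: "q = ln 20 + L" using \<delta> by (simp add: q_def L_def ln_div)
  have "ln (20 :: real) \<le> 5" using ln_le_numeral[of 20 5] by simp
  \<comment> \<open>From \<open>ln 20 \<le> 5\<close> the left side is at most
    \<open>12 + L\<close>, and \<open>12 \<le> 18 * L\<close> since \<open>L \<ge> 2 / 3\<close>;
    here \<delta> \<le> 1/2 enters.\<close>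
  then have q_le: "q + 7 \<le> 19 * L" using L q_eq by linarith
  have "ln (exp 1) \<le> ln (20 :: real)" using exp_le by (subst ln_le_cancel_iff) auto
  then have q_ge: "1 \<le> q" using L q_eq by simp
  have \<delta>_eq: "20 * exp (- q) = \<delta>" using \<delta> by (simp add: q_def exp_minus)
  show "\<exists>A. valid_policy n A \<and>
      (\<forall>D b. bandit_instance n D \<and> b < n \<and> (\<forall>j<n. j \<noteq> b \<longrightarrow> mean (D j) < mean (D b)) \<longrightarrow>
        (let \<theta> = (\<lambda>i. mean (D i)); \<Delta> = gap n \<theta> b in
         measure (outcome_space n D)
           (success_event n D A b
              (57066880 * (\<Sum>i<n. (var (D i) / (\<Delta> i)^2 + 1 / \<Delta> i) * (ln (1/\<delta>) + LL (1 / \<Delta> i)))))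
         \<ge> 1 - \<delta>))"
  proof (intro exI[of _ "policy n q"] conjI allI impI)
    show "valid_policy n (policy n q)" by (rule valid_policy_policy[OF n])
    fix D b
    assume inst: "bandit_instance n D \<and> b < n \<and> (\<forall>j<n. j \<noteq> b \<longrightarrow> mean (D j) < mean (D b))"
    then have b: "b < n" "\<forall>j<n. j \<noteq> b \<longrightarrow> mean (D j) < mean (D b)" by auto
    interpret bandit n D by unfold_locales (use inst n in auto)
    show "let \<theta> = (\<lambda>i. mean (D i)); \<Delta> = gap n \<theta> b in
         measure (outcome_space n D)
           (success_event n D (policy n q) b
              (57066880 * (\<Sum>i<n. (var (D i) / (\<Delta> i)^2 + 1 / \<Delta> i) * (ln (1/\<delta>) + LL (1 / \<Delta> i)))))
         \<ge> 1 - \<delta>"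
      using prob_success[OF n b q_ge q_le refl] unfolding \<delta>_eq L_def Let_def .
  qed
qed simp

end
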